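(* Let $n\ge 3$ be an integer and let $g,h,f\in\mathrm{Tame}(\mathbf{k}^3)$ be defined by $g^{-1}(x_1,x_2,x_3)=(x_2,\,x_1+x_2x_3,\,x_3)$, $h^{-1}(x_1,x_2,x_3)=(x_3,x_1,x_2)$ and $f=g^n\circ h$. Then $f$ acts as a loxodromic isometry on $\mathcal{C}^1$. In particular $\mathcal{C}^1$ has infinite diameter.
   Context: Let $\mathbf{k}$ be a field of characteristic zero. Let $A_3=\mathrm{GL}_3(\mathbf{k})\ltimes\mathbf{k}^3$ be the group of affine automorphisms of $\mathbf{k}^3$ and $E_3=\{(x_1+P(x_2,x_3),x_2,x_3): P\in\mathbf{k}[x_2,x_3]\}$. The tame automorphism group is $\mathrm{Tame}(\mathbf{k}^3)=\langle A_3,E_3\rangle\subset\mathrm{Aut}(\mathbf{k}^3)$. For $r\in\{1,2,3\}$, an $r$-tuple of components is a polynomial map $(f_1,\dots,f_r)\colon\mathbf{k}^3\to\mathbf{k}^r$ which is the list of the first $r$ components of some $(f_1,f_2,f_3)\in\mathrm{Tame}(\mathbf{k}^3)$. A vertex of type $r$ is an orbit $[f_1,\dots,f_r]=\{a\circ(f_1,\dots,f_r): a\in A_r\}$, where $A_r=\mathrm{GL}_r(\mathbf{k})\ltimes\mathbf{k}^r$ acts by post-composition. The complex $\mathcal{C}$ is the 2-dimensional simplicial complex whose vertices are all vertices of types 1, 2, 3, and whose simplices are, for every $(f_1,f_2,f_3)\in\mathrm{Tame}(\mathbf{k}^3)$, the triangle spanned by $[f_1],[f_1,f_2],[f_1,f_2,f_3]$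 together with its faces. $\mathrm{Tame}(\mathbf{k}^3)$ acts on $\mathcal{C}$ by $g\cdot[f_1,\dots,f_r]=[f_1\circ g^{-1},\dots,f_r\circ g^{-1}]$. $\mathcal{C}^1$ is the 1-skeleton of $\mathcal{C}$ with the path metric where each edge has length $1$. An isometry $f$ of a metric space $X$ is loxodromic if for some (equivalently any) $x\in X$ there is $\lambda>0$ with $d(x,f^k\cdot x)\ge\lambda|k|$ for all $k\in\mathbb{Z}$. *)

theory Defs
  imports Complex_Main
begin

text \<open>Points of k^3 are triples (x1, x2, x3) :: 'a \<times> 'a \<times> 'a.
  Since k has characteristic zero it is infinite, so polynomials are
  faithfully represented by the polynomial functions they induce.\<close>

type_synonym 'a pt3 = "'a \<times> 'a \<times> 'a"

inductive polyfun2 :: "('a::comm_ring_1 \<times> 'a \<Rightarrow> 'a) \<Rightarrow> bool" where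
  pf2_const: "polyfun2 (\<lambda>_. c)"
| pf2_fst: "polyfun2 fst"
| pf2_snd: "polyfun2 snd"
| pf2_add: "polyfun2 p \<Longrightarrow> polyfun2 q \<Longrightarrow> polyfun2 (\<lambda>x. p x + q x)"
| pf2_mult: "polyfun2 p \<Longrightarrow> polyfun2 q \<Longrightarrow> polyfun2 (\<lambda>x. p x * q x)"

definition invertible_mat :: "nat \<Rightarrow> (nat \<Rightarrow> nat \<Rightarrow> 'a::comm_ring_1) \<Rightarrow> bool" where
  "invertible_mat r M \<longleftrightarrow> (\<exists>N. \<forall>i<r. \<forall>j<r.
      (\<Sum>l<r. N i l * M l j) = (if i = j then 1 else 0) \<and>
      (\<Sum>l<r. M i l * N l j) = (if i = j then 1 else 0))"

definition affine3 :: "('a::comm_ring_1 pt3 \<Rightarrow> 'a pt3) set" where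
  "affine3 = {F. \<exists>M (c :: nat \<Rightarrow> _). invertible_mat 3 M \<and>
     F = (\<lambda>(x1, x2, x3).
        (M 0 0 * x1 + M 0 1 * x2 + M 0 2 * x3 + c 0,
         M 1 0 * x1 + M 1 1 * x2 + M 1 2 * x3 + c 1,
         M 2 0 * x1 + M 2 1 * x2 + M 2 2 * x3 + c 2))}"

definition elem3 :: "('a::comm_ring_1 pt3 \<Rightarrow> 'a pt3) set" where
  "elem3 = {F. \<exists>P. polyfun2 P \<and> F = (\<lambda>(x1, x2, x3). (x1 + P (x2, x3), x2, x3))}"

text \<open>Tame(k^3) = subgroup of Aut(k^3) generated by A_3 and E_3 (all generators are
  bijections of k^3, so inverses are the set-theoretic inverses).\<close>
inductive tame :: "('a::field pt3 \<Rightarrow> 'a pt3) \<Rightarrow> bool" where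
  tame_id: "tame id"
| tame_gen: "tame g \<Longrightarrow> a \<in> affine3 \<union> elem3 \<Longrightarrow> tame (a \<circ> g)"
| tame_gen_inv: "tame g \<Longrightarrow> a \<in> affine3 \<union> elem3 \<Longrightarrow> tame (inv a \<circ> g)"

definition comps :: "('a pt3 \<Rightarrow> 'a pt3) \<Rightarrow> ('a pt3 \<Rightarrow> 'a) list" where
  "comps F = [(\<lambda>x. fst (F x)), (\<lambda>x. fst (snd (F x))), (\<lambda>x. snd (snd (F x)))]"

text \<open>The vertex [f_1,...,f_r]: the orbit of the r-tuple (a list of length r)
  under A_r acting by post-composition.\<close>
definition vtx :: "('a::field pt3 \<Rightarrow> 'a) list \<Rightarrow> ('a pt3 \<Rightarrow> 'a) list set" where
  "vtx fs = {gs. length gs = length fs \<and>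
     (\<exists>M c. invertible_mat (length fs) M \<and>
        (\<forall>i<length fs. gs ! i = (\<lambda>x. (\<Sum>j<length fs. M i j * (fs ! j) x) + c i)))}"

definition triangle :: "('a::field pt3 \<Rightarrow> 'a pt3) \<Rightarrow> ('a pt3 \<Rightarrow> 'a) list set set" where
  "triangle F = {vtx (take 1 (comps F)), vtx (take 2 (comps F)), vtx (comps F)}"

definition C_vertices :: "('a::field pt3 \<Rightarrow> 'a) list set set" where
  "C_vertices = (\<Union>F\<in>{F. tame F}. triangle F)"

definition C_adj :: "('a::field pt3 \<Rightarrow> 'a) list set \<Rightarrow> ('a pt3 \<Rightarrow> 'a) list set \<Rightarrow> bool" where
  "C_adj u v \<longleftrightarrow> u \<noteq> v \<and> (\<exists>F. tame F \<and> u \<in> triangle F \<and> v \<in> triangle F)"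

text \<open>Edge paths of length n in C^1; the path metric d(u,v) is the least such n.\<close>
inductive C_walk :: "nat \<Rightarrow> ('a::field pt3 \<Rightarrow> 'a) list set \<Rightarrow> ('a pt3 \<Rightarrow> 'a) list set \<Rightarrow> bool" where
  walk_nil: "u \<in> C_vertices \<Longrightarrow> C_walk 0 u u"
| walk_cons: "C_adj u v \<Longrightarrow> C_walk n v w \<Longrightarrow> C_walk (Suc n) u w"

definition act :: "('a pt3 \<Rightarrow> 'a pt3) \<Rightarrow> ('a pt3 \<Rightarrow> 'a) list set \<Rightarrow> ('a pt3 \<Rightarrow> 'a) list set" where
  "act g V = map (\<lambda>\<phi>. \<phi> \<circ> inv g) ` V"

definition ipow :: "('b \<Rightarrow> 'b) \<Rightarrow> int \<Rightarrow> ('b \<Rightarrow> 'b)" where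
  "ipow f k = (if 0 \<le> k then f ^^ nat k else inv f ^^ nat (- k))"

text \<open>Loxodromic: d(x, f^k x) \<ge> \<lambda>|k| for all k (pairs in different components
  would be at infinite distance, which is consistent with the bound).\<close>
definition loxodromic :: "('a::field pt3 \<Rightarrow> 'a pt3) \<Rightarrow> bool" where
  "loxodromic f \<longleftrightarrow> (\<exists>x\<in>C_vertices. \<exists>lam::real. lam > 0 \<and>
     (\<forall>k::int. \<forall>n. C_walk n x (act (ipow f k) x) \<longrightarrow> real n \<ge> lam * \<bar>real_of_int k\<bar>))"

definition infinite_diameter :: "'a::field itself \<Rightarrow> bool" where
  "infinite_diameter _ \<longleftrightarrow> (\<forall>N::nat. \<exists>u v :: ('a pt3 \<Rightarrow> 'a) list set.
     u \<in> C_vertices \<and> v \<in> C_vertices \<and> \<not> (\<exists>n\<le>N. C_walk n u v))"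

definition g_inv_map :: "'a::comm_ring_1 pt3 \<Rightarrow> 'a pt3" where
  "g_inv_map = (\<lambda>(x1, x2, x3). (x2, x1 + x2 * x3, x3))"

definition h_inv_map :: "'a pt3 \<Rightarrow> 'a pt3" where
  "h_inv_map = (\<lambda>(x1, x2, x3). (x3, x1, x2))"

end

theory Submission
  imports Defs "HOL-Computational_Algebra.Polynomial"
begin

text \<open>
  The map \<open>\<phi> = f\<^sup>-\<^sup>1\<close> has components \<open>x\<^sub>3\<close>, \<open>p\<^sub>n\<close>, \<open>p\<^sub>n\<^sub>+\<^sub>1\<close> with leading monomials
  \<open>x\<^sub>3\<close>, \<open>x\<^sub>2 x\<^sub>3^(n-1)\<close>, \<open>x\<^sub>2 x\<^sub>3^n\<close>. Call a polynomial forward, for given positive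
  weights, if its leading form does not involve \<open>x\<^sub>1\<close>. If \<open>u\<close> is forward, then \<open>u \<circ> \<phi>\<close> is forward
  for suitably pulled back weights, and its leading form is moreover divisible by \<open>x\<^sub>2 x\<^sub>3\<close>.

  If \<open>u\<close> and \<open>v\<close> are components of one polynomial automorphism, both are invariant under a nontrivial
  algebraic action of the additive group, namely translation of a third component. Degenerating the
  action along the weights, with the right weight on the time parameter \<open>t\<close>, gives a nontrivial
  polynomial map \<open>X(x, t)\<close> preserving the leading forms of \<open>u\<close> and \<open>v\<close>. When the former is divisible
  by \<open>x\<^sub>2 x\<^sub>3\<close>, the polynomials \<open>X\<^sub>2\<close> and \<open>X\<^sub>3\<close> divide a nonzero constant of \<open>k[t]\<close>, so \<open>X\<close> moves only
  \<open>x\<^sub>1\<close>, and the leading form of \<open>v\<close> cannot involve \<open>x\<^sub>1\<close>: \<open>v\<close> is forward.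

  Hence the largest \<open>j\<close> for which some component \<open>u\<close> belonging to a vertex has \<open>u \<circ> f^j\<close> forward
  changes by at most one along an edge. As \<open>x\<^sub>1\<close> is not forward but \<open>x\<^sub>1 \<circ> \<phi> = x\<^sub>3\<close> is, it
  increases by \<open>k\<close> from \<open>[x\<^sub>1]\<close> to \<open>f^k [x\<^sub>1]\<close>, so these vertices are at distance at least \<open>|k|\<close>.
\<close>

section \<open>Polynomial functions\<close>

text \<open>Variables are indexed by all natural numbers, so that functions of three, four or five
  scalars share one set of closure rules.\<close>

inductive pfun :: "((nat \<Rightarrow> 'a::comm_ring_1) \<Rightarrow> 'a) \<Rightarrow> bool" where
  pfun_const [intro!]: "pfun (\<lambda>_. c)"
| pfun_var [intro!]: "pfun (\<lambda>y. y i)"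
| pfun_add [intro!]: "pfun P \<Longrightarrow> pfun Q \<Longrightarrow> pfun (\<lambda>y. P y + Q y)"
| pfun_mult [intro!]: "pfun P \<Longrightarrow> pfun Q \<Longrightarrow> pfun (\<lambda>y. P y * Q y)"

lemma pfun_uminus [intro!]: "pfun P \<Longrightarrow> pfun (\<lambda>y. - P y)"
  using pfun_mult[OF pfun_const[of "-1"]] by simp

lemma pfun_diff [intro!]: "pfun P \<Longrightarrow> pfun Q \<Longrightarrow> pfun (\<lambda>y. P y - Q y)"
  using pfun_add[OF _ pfun_uminus] by fastforce

lemma pfun_power [intro!]: "pfun P \<Longrightarrow> pfun (\<lambda>y. P y ^ k)"
  by (induction k) auto

lemma pfun_sum [intro!]: "(\<And>k. k \<in> A \<Longrightarrow> pfun (P k)) \<Longrightarrow> pfun (\<lambda>y. \<Sum>k\<in>A. P k y)"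
  by (induction A rule: infinite_finite_induct) auto

lemma pfun_If [intro!]: "pfun P \<Longrightarrow> pfun Q \<Longrightarrow> pfun (\<lambda>y. if b then P y else Q y)"
  by (cases b) simp_all

lemma pfun_compose:
  assumes "pfun P" "\<And>i. pfun (Q i)"
  shows "pfun (\<lambda>y. P (\<lambda>i. Q i y))"
  using assms by (induction rule: pfun.induct) auto

text \<open>Restricting to a polynomial curve reduces questions in several variables to the
  one-variable ring \<open>'a poly\<close>.\<close>

lemma pfun_along_curve:
  assumes "pfun P"
  shows "\<exists>q. \<forall>r. P (\<lambda>i. poly (l i) r) = poly q r"
  using assms
proof (induction rule: pfun.induct)
  case (pfun_const c)
  show ?case by (rule exI[of _ "[:c:]"]) simp
next
  case (pfun_add P Q)
  then show ?case by (metis poly_add)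
next
  case (pfun_mult P Q)
  then show ?case by (metis poly_mult)
qed blast

text \<open>On the line through \<open>a\<close> at time 0 and \<open>b\<close> at time 1, the
  product becomes a polynomial vanishing on an infinite field, so one factor is zero, and it is not
  that of \<open>P\<close>. This serves as density of the locus where \<open>P\<close> is
  nonzero.\<close>

lemma pfun_no_zero_divisors:
  fixes P Q :: "(nat \<Rightarrow> 'a::field_char_0) \<Rightarrow> 'a"
  assumes "pfun P" "pfun Q" "\<And>y. P y * Q y = 0" "P a \<noteq> 0"
  shows "Q b = 0"
proof -
  define l where "l = (\<lambda>i. [:a i, b i - a i:])"
  have l0: "(\<lambda>i. poly (l i) 0) = a" and l1: "(\<lambda>i. poly (l i) 1) = b"
    by (simp_all add: l_def)
  obtain p where p: "\<And>r. P (\<lambda>i. poly (l i) r) = poly p r"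
    using pfun_along_curve[OF assms(1)] by metis
  obtain q where q: "\<And>r. Q (\<lambda>i. poly (l i) r) = poly q r"
    using pfun_along_curve[OF assms(2)] by metis
  have "poly (p * q) = poly 0"
    using assms(3) p q by (auto simp: fun_eq_iff) metis
  then have "p * q = 0"
    by (simp only: poly_eq_poly_eq_iff)
  moreover have "p \<noteq> 0"
    using p[of 0] l0 assms(4) by auto
  ultimately show ?thesis
    using q[of 1] l1 by simp
qed

lemma pfun_eq_if_eq_off_zero:
  fixes P Q :: "(nat \<Rightarrow> 'a::field_char_0) \<Rightarrow> 'a"
  assumes "pfun P" "pfun Q" "\<And>y. y i \<noteq> 0 \<Longrightarrow> P y = Q y"
  shows "P = Q"
proof
  fix y
  have "P y - Q y = 0"
    by (rule pfun_no_zero_divisors[of "\<lambda>y. y i" "\<lambda>y. P y - Q y" "\<lambda>_. 1"])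
       (use assms in auto)
  then show "P y = Q y" by simp
qed

text \<open>Division with remainder by the variable \<open>y 0\<close>; it later removes a factor
  \<open>s\<close> from a homogenisation and extracts \<open>x_2 x_3\<close> from a leading
  form.\<close>

lemma pfun_split_at_zero:
  assumes "pfun P"
  shows "\<exists>R. pfun R \<and> (\<forall>y. P y = P (y(0 := 0)) + y 0 * R y)"
  using assms
proof (induction rule: pfun.induct)
  case (pfun_const c)
  show ?case by (rule exI[of _ "\<lambda>_. 0"]) auto
next
  case (pfun_var i)
  show ?case
    by (rule exI[of _ "\<lambda>_. if i = 0 then 1 else 0"]) auto
next
  case (pfun_add P Q)
  then obtain R S where R: "pfun R" "\<And>y. P y = P (y(0 := 0)) + y 0 * R y"
    and S: "pfun S" "\<And>y. Q y = Q (y(0 := 0)) + y 0 * S y" by blast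
  have "P y + Q y = P (y(0 := 0)) + Q (y(0 := 0)) + y 0 * (R y + S y)" for y
    by (subst R(2), subst S(2)) (simp add: algebra_simps)
  then show ?case using pfun.pfun_add[OF R(1) S(1)] by blast
next
  case (pfun_mult P Q)
  then obtain R S where R: "pfun R" "\<And>y. P y = P (y(0 := 0)) + y 0 * R y"
    and S: "pfun S" "\<And>y. Q y = Q (y(0 := 0)) + y 0 * S y" by blast
  have upd: "pfun (\<lambda>y. A (y(0 := 0)))" if "pfun A" for A :: "(nat \<Rightarrow> 'a) \<Rightarrow> 'a"
  proof -
    have "pfun (\<lambda>y. A (\<lambda>i. if i = 0 then 0 else y i))"
      by (rule pfun_compose[OF that]) auto
    then show ?thesis by (simp add: fun_upd_def)
  qed
  \<comment> \<open>With \<open>P0\<close>, \<open>Q0\<close> the values at \<open>y 0 = 0\<close>: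
    \<open>P Q - P0 Q0 = P0 (Q - Q0) + (P - P0) Q\<close>.\<close>
  have "P y * Q y = P (y(0 := 0)) * Q (y(0 := 0))
      + y 0 * (P (y(0 := 0)) * S y + R y * Q y)" for y
    by (subst (2) S(2), subst (1) R(2), subst (1) S(2)) (simp add: algebra_simps)
  moreover have "pfun (\<lambda>y. P (y(0 := 0)) * S y + R y * Q y)"
    using upd[of P] R(1) S(1) pfun_mult.hyps by auto
  ultimately show ?case
    by (intro exI[of _ "\<lambda>y. P (y(0 := 0)) * S y + R y * Q y"]) blast
qed

text \<open>Powers of \<open>y 0\<close> are collected. The degree bound is uniform in
  \<open>y\<close>, so that a flow gets a single finite expansion in powers of time.\<close>

lemma pfun_coeffs:
  assumes "pfun P"
  shows "\<exists>q D. (\<forall>m. pfun (\<lambda>y. coeff (q y) m)) \<and> (\<forall>y. degree (q y) \<le> D)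
    \<and> (\<forall>y r. P (y(0 := r)) = poly (q y) r)"
  using assms
proof (induction rule: pfun.induct)
  case (pfun_const c)
  show ?case by (rule exI[of _ "\<lambda>_. [:c:]"]) auto
next
  case (pfun_var i)
  show ?case
  proof (cases "i = 0")
    case True
    then show ?thesis by (intro exI[of _ "\<lambda>_. [:0, 1:]"] exI[of _ 1]) auto
  next
    case False
    then show ?thesis
      by (intro exI[of _ "\<lambda>y. [:y i:]"] exI[of _ 0])
         (auto simp: coeff_pCons' intro!: pfun_If)
  qed
next
  case (pfun_add P Q)
  then obtain p D q E where
    p: "\<And>m. pfun (\<lambda>y. coeff (p y) m)" "\<And>y. degree (p y) \<le> D" "\<And>y r. P (y(0 := r)) = poly (p y) r"
    and q: "\<And>m. pfun (\<lambda>y. coeff (q y) m)" "\<And>y. degree (q y) \<le> E" "\<And>y r. Q (y(0 := r)) = poly (q y) r"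
    by metis
  have "degree (p y + q y) \<le> max D E" for y
    using p(2)[of y] q(2)[of y] by (intro degree_add_le) auto
  then show ?case
    by (intro exI[of _ "\<lambda>y. p y + q y"] exI[of _ "max D E"])
       (auto simp: p(1) q(1) p(3) q(3) simp del: fun_upd_apply)
next
  case (pfun_mult P Q)
  then obtain p D q E where
    p: "\<And>m. pfun (\<lambda>y. coeff (p y) m)" "\<And>y. degree (p y) \<le> D" "\<And>y r. P (y(0 := r)) = poly (p y) r"
    and q: "\<And>m. pfun (\<lambda>y. coeff (q y) m)" "\<And>y. degree (q y) \<le> E" "\<And>y r. Q (y(0 := r)) = poly (q y) r"
    by metis
  have "degree (p y * q y) \<le> D + E" for y
    using degree_mult_le[of "p y" "q y"] p(2)[of y] q(2)[of y] by linarith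
  moreover have "pfun (\<lambda>y. coeff (p y * q y) m)" for m
    unfolding coeff_mult by (intro pfun_sum pfun.pfun_mult p(1) q(1))
  ultimately show ?case
    by (intro exI[of _ "\<lambda>y. p y * q y"] exI[of _ "D + E"])
       (simp add: p(3) q(3) del: fun_upd_apply)
qed

text \<open>Slot 0 holds the homogenising variable, the original variables move up by one. For a sum
  the two exponents are added, so \<open>d\<close> can be too large;
  \<open>homogenised_exists\<close> removes the surplus.\<close>

lemma pfun_homogenisation:
  assumes "pfun P"
  shows "\<exists>d Q. pfun Q \<and> (\<forall>y. Q (\<lambda>i. case i of 0 \<Rightarrow> y 0 | Suc j \<Rightarrow> y 0 ^ W j * y (Suc j))
    = y 0 ^ d * P (\<lambda>j. y (Suc j)))"
  using assms
proof (induction rule: pfun.induct)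
  case (pfun_const c)
  show ?case by (intro exI[of _ 0] exI[of _ "\<lambda>_. c"]) auto
next
  case (pfun_var i)
  show ?case by (intro exI[of _ "W i"] exI[of _ "\<lambda>y. y (Suc i)"]) auto
next
  case (pfun_add P1 P2)
  then obtain d1 Q1 d2 Q2 where Q: "pfun Q1" "pfun Q2"
    and e: "\<And>y. Q1 (\<lambda>i. case i of 0 \<Rightarrow> y 0 | Suc j \<Rightarrow> y 0 ^ W j * y (Suc j)) = y 0 ^ d1 * P1 (\<lambda>j. y (Suc j))"
      "\<And>y. Q2 (\<lambda>i. case i of 0 \<Rightarrow> y 0 | Suc j \<Rightarrow> y 0 ^ W j * y (Suc j)) = y 0 ^ d2 * P2 (\<lambda>j. y (Suc j))"
    by blast
  show ?case
    by (intro exI[of _ "d1 + d2"] exI[of _ "\<lambda>y. y 0 ^ d2 * Q1 y + y 0 ^ d1 * Q2 y"])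
       (use Q in \<open>auto simp: e power_add algebra_simps\<close>)
next
  case (pfun_mult P1 P2)
  then obtain d1 Q1 d2 Q2 where Q: "pfun Q1" "pfun Q2"
    and e: "\<And>y. Q1 (\<lambda>i. case i of 0 \<Rightarrow> y 0 | Suc j \<Rightarrow> y 0 ^ W j * y (Suc j)) = y 0 ^ d1 * P1 (\<lambda>j. y (Suc j))"
      "\<And>y. Q2 (\<lambda>i. case i of 0 \<Rightarrow> y 0 | Suc j \<Rightarrow> y 0 ^ W j * y (Suc j)) = y 0 ^ d2 * P2 (\<lambda>j. y (Suc j))"
    by blast
  show ?case
    by (intro exI[of _ "d1 + d2"] exI[of _ "\<lambda>y. Q1 y * Q2 y"])
       (use Q in \<open>auto simp: e power_add algebra_simps\<close>)
qed

section \<open>Polynomial functions of a point and up to two scalars\<close>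

definition poly3 :: "('a::comm_ring_1 pt3 \<Rightarrow> 'a) \<Rightarrow> bool" where
  "poly3 u \<longleftrightarrow> pfun (\<lambda>y. u (y 0, y 1, y 2))"

text \<open>Scalars occupy the low slots because slot 0 is the variable singled out by
  \<open>pfun_coeffs\<close> and \<open>pfun_split_at_zero\<close>: time for a flow,
  \<open>s\<close> for a homogenisation. In \<open>poly5\<close>, slot 0 is \<open>s\<close> and
  slot 1 is time.\<close>

definition poly4 :: "('a::comm_ring_1 pt3 \<Rightarrow> 'a \<Rightarrow> 'a) \<Rightarrow> bool" where
  "poly4 U \<longleftrightarrow> pfun (\<lambda>y. U (y 1, y 2, y 3) (y 0))"

definition poly5 :: "('a::comm_ring_1 pt3 \<Rightarrow> 'a \<Rightarrow> 'a \<Rightarrow> 'a) \<Rightarrow> bool" where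
  "poly5 U \<longleftrightarrow> pfun (\<lambda>y. U (y 2, y 3, y 4) (y 1) (y 0))"

lemma poly3_compose:
  assumes "poly3 u" "pfun A" "pfun B" "pfun C"
  shows "pfun (\<lambda>y. u (A y, B y, C y))"
  using pfun_compose[OF assms(1)[unfolded poly3_def], of "\<lambda>i. if i = 0 then A else if i = 1 then B else C"]
    assms by simp

lemma poly4_compose:
  assumes "poly4 U" "pfun A" "pfun B" "pfun C" "pfun D"
  shows "pfun (\<lambda>y. U (A y, B y, C y) (D y))"
  using pfun_compose[OF assms(1)[unfolded poly4_def],
      of "\<lambda>i. if i = 0 then D else if i = 1 then A else if i = 2 then B else C"]
    assms by simp

lemma poly5_compose:
  assumes "poly5 U" "pfun A" "pfun B" "pfun C" "pfun D" "pfun E"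
  shows "pfun (\<lambda>y. U (A y, B y, C y) (D y) (E y))"
  using pfun_compose[OF assms(1)[unfolded poly5_def],
      of "\<lambda>i. if i = 0 then E else if i = 1 then D else if i = 2 then A else if i = 3 then B else C"]
    assms by simp

text \<open>Every index from 2 on means the third coordinate, so polynomiality of components can be
  stated for all \<open>i\<close>.\<close>

definition co :: "nat \<Rightarrow> 'a pt3 \<Rightarrow> 'a" where
  "co i x = (if i = 0 then fst x else if i = 1 then fst (snd x) else snd (snd x))"

lemma co_simps [simp]:
  "co 0 x = fst x" "co (Suc 0) x = fst (snd x)" "co 2 x = snd (snd x)"
  by (simp_all add: co_def)

lemma pfun_co [intro!]:
  "pfun A \<Longrightarrow> pfun B \<Longrightarrow> pfun C \<Longrightarrow> pfun (\<lambda>y. co i (A y, B y, C y))"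
  by (auto simp: co_def)

lemma all_less_3: "(\<forall>i<3. P i) \<longleftrightarrow> P 0 \<and> P (Suc 0) \<and> P (2::nat)"
  by (auto simp: numeral_3_eq_3 numeral_2_eq_2 less_Suc_eq)

lemma pt3_eqI: "(\<And>i. i < 3 \<Longrightarrow> co i x = co i y) \<Longrightarrow> x = y"
  using all_less_3[of "\<lambda>i. co i x = co i y"] by (simp add: prod_eq_iff)

section \<open>Weighted leading forms\<close>

definition scale :: "(nat \<Rightarrow> nat) \<Rightarrow> 'a::comm_ring_1 \<Rightarrow> 'a pt3 \<Rightarrow> 'a pt3" where
  "scale W s x = (s ^ W 0 * fst x, s ^ W 1 * fst (snd x), s ^ W 2 * snd (snd x))"

lemma co_scale: "i < 3 \<Longrightarrow> co i (scale W s x) = s ^ W i * co i x"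
  by (auto simp: scale_def co_def numeral_3_eq_3 numeral_2_eq_2 less_Suc_eq)

lemma scale_surj:
  fixes s :: "'a::field"
  assumes "s \<noteq> 0"
  obtains y where "x = scale W s y"
proof
  show "x = scale W s (fst x / s ^ W 0, fst (snd x) / s ^ W 1, snd (snd x) / s ^ W 2)"
    using assms by (simp add: scale_def)
qed

lemma scale_0: "(\<And>i. W i > (0::nat)) \<Longrightarrow> scale W 0 x = (0, 0, 0)"
  by (simp add: scale_def zero_power)

text \<open>\<open>U\<close> is the homogenisation of \<open>u\<close> by a variable \<open>s\<close> of weight one,
  so that \<open>\<lambda>x. U x 0\<close> is the leading form of \<open>u\<close>, of weighted degree \<open>d\<close>.\<close>
definition homogenised :: "(nat \<Rightarrow> nat) \<Rightarrow> ('a::comm_ring_1 pt3 \<Rightarrow> 'a) \<Rightarrow> nat \<Rightarrow> ('a pt3 \<Rightarrow> 'a \<Rightarrow> 'a) \<Rightarrow> bool" where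
  "homogenised W u d U \<longleftrightarrow> poly4 U \<and> (\<forall>x s. U (scale W s x) s = s ^ d * u x) \<and> (\<exists>x. U x 0 \<noteq> 0)"

text \<open>Take the least exponent admitting a polynomial homogenisation. If it vanished on
  \<open>s = 0\<close>, a factor \<open>s\<close> could be divided out, giving a smaller
  exponent.\<close>

lemma homogenised_exists:
  fixes u :: "'a::field_char_0 pt3 \<Rightarrow> 'a"
  assumes "poly3 u" "u z \<noteq> 0"
  obtains d U where "homogenised W u d U"
proof -
  define good where "good d \<longleftrightarrow> (\<exists>U. poly4 U \<and> (\<forall>x s. U (scale W s x) s = s ^ d * u x))" for d
  obtain d Q where Q: "pfun Q" "\<And>y. Q (\<lambda>i. case i of 0 \<Rightarrow> y 0 | Suc j \<Rightarrow> y 0 ^ W j * y (Suc j))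
    = y 0 ^ d * u (y 1, y 2, y 3)"
    using pfun_homogenisation[OF assms(1)[unfolded poly3_def], of W]
    by (auto simp: numeral_2_eq_2 numeral_3_eq_3)
  define U where "U x s = Q (\<lambda>i. case i of 0 \<Rightarrow> s | Suc j \<Rightarrow> if j < 3 then co j x else 0)" for x s
  have "pfun (\<lambda>y. Q (\<lambda>i. case i of 0 \<Rightarrow> y 0 | Suc j \<Rightarrow> if j < 3 then co j (y 1, y 2, y 3) else 0))"
    by (rule pfun_compose[OF Q(1)], case_tac i) auto
  then have "poly4 U" by (simp add: poly4_def U_def del: One_nat_def)
  moreover have "U (scale W s x) s = s ^ d * u x" for x s
  proof -
    define e where "e i = (case i of 0 \<Rightarrow> s | Suc j \<Rightarrow> if j < 3 then co j x else 0)" for i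
    have "(\<lambda>i. case i of 0 \<Rightarrow> s | Suc j \<Rightarrow> if j < 3 then co j (scale W s x) else 0)
      = (\<lambda>i. case i of 0 \<Rightarrow> e 0 | Suc j \<Rightarrow> e 0 ^ W j * e (Suc j))"
      by (auto simp: co_scale fun_eq_iff e_def split: nat.splits)
    moreover have "e 0 = s" "(e 1, e 2, e 3) = x"
      by (simp_all add: e_def eval_nat_numeral co_def)
    ultimately show ?thesis
      using Q(2)[of e] by (simp only: U_def)
  qed
  ultimately have "good d" unfolding good_def by blast
  define e where "e = (LEAST d. good d)"
  have "good e" unfolding e_def using \<open>good d\<close> by (rule LeastI)
  then obtain V where V: "poly4 V" "\<And>x s. V (scale W s x) s = s ^ e * u x"
    unfolding good_def by blast
  have "\<exists>x. V x 0 \<noteq> 0"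
  proof (rule ccontr)
    assume "\<not> ?thesis"
    then have V0: "\<And>x. V x 0 = 0" by blast
    obtain R where R: "pfun R" "\<And>y. V (y 1, y 2, y 3) (y 0) = y 0 * R y"
      using pfun_split_at_zero[OF V(1)[unfolded poly4_def]] V0 by auto
    define R' where "R' x s = R (\<lambda>i. if i = 0 then s else co (i - 1) x)" for x s
    have pR': "poly4 R'"
      unfolding poly4_def R'_def by (rule pfun_compose[OF R(1)]) auto
    have eq: "s * R' (scale W s x) s = s ^ e * u x" for x s
      using R(2)[of "\<lambda>i. if i = 0 then s else co (i - 1) (scale W s x)"] V(2)[of s x]
      by (simp add: R'_def eval_nat_numeral co_def)
    \<comment> \<open>For exponent 0, putting \<open>s = 0\<close> gives \<open>u z = 0\<close>.
      Otherwise one \<open>s\<close> is cancelled where \<open>s\<close> is nonzero, and the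
      identity extends to \<open>s = 0\<close>.\<close>
    show False
    proof (cases e)
      case 0
      then show False using eq[of 0 z] assms(2) by simp
    next
      case (Suc e')
      have "(\<lambda>y :: nat \<Rightarrow> 'a. R' (scale W (y 0) (y 1, y 2, y 3)) (y 0)) = (\<lambda>y. y 0 ^ e' * u (y 1, y 2, y 3))"
      proof (rule pfun_eq_if_eq_off_zero[where i = 0])
        show "pfun (\<lambda>y. R' (scale W (y 0) (y 1, y 2, y 3)) (y 0))"
          unfolding scale_def by (intro poly4_compose[OF pR']) auto
        show "pfun (\<lambda>y. y 0 ^ e' * u (y 1, y 2, y 3))"
          by (intro pfun_mult poly3_compose[OF assms(1)]) auto
        fix y :: "nat \<Rightarrow> 'a" assume "y 0 \<noteq> 0"
        then show "R' (scale W (y 0) (y 1, y 2, y 3)) (y 0) = y 0 ^ e' * u (y 1, y 2, y 3)"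
          using eq[of "y 0" "(y 1, y 2, y 3)"] Suc by simp
      qed
      then have "R' (scale W s x) s = s ^ e' * u x" for x s
        by (drule_tac x = "\<lambda>i. if i = 0 then s else co (i - 1) x" in fun_cong)
           (simp add: eval_nat_numeral co_def)
      then have "good e'" unfolding good_def using pR' by blast
      then show False using Least_le[of good e'] Suc e_def by simp
    qed
  qed
  then show ?thesis using V that unfolding homogenised_def by blast
qed

text \<open>In degree 0, putting \<open>s = 0\<close> collapses all points to the origin and makes
  \<open>u\<close> constant.\<close>

lemma homogenised_degree_pos:
  assumes "homogenised W u d U" "\<And>i. W i > 0" "u x \<noteq> u y"
  shows "d > 0"
proof (rule ccontr)
  assume "\<not> d > 0"
  then have "U (scale W 0 x) 0 = u x" for x
    using assms(1) unfolding homogenised_def by (metis gr0I mult_1 power_0)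
  then show False using assms(2,3) by (metis scale_0)
qed

lemma homogenised_origin:
  assumes "homogenised W u d U" "\<And>i. W i > 0" "d > 0"
  shows "U (0, 0, 0) 0 = 0"
proof -
  have "U (scale W 0 (0, 0, 0)) 0 = 0 ^ d * u (0, 0, 0)"
    using assms(1) by (simp only: homogenised_def)
  then show ?thesis using assms(2,3) by (simp add: scale_0 zero_power)
qed

lemma scale_mult: "scale (\<lambda>i. M * W i) s x = scale W (s ^ M) x"
  by (simp add: scale_def power_mult)

text \<open>Replacing \<open>s\<close> by \<open>s ^ M\<close> keeps the leading form and matches
  the rescaled weights of \<open>degenerate_flow\<close>.\<close>

lemma homogenised_mult:
  assumes "homogenised W u d U" "M > 0"
  shows "homogenised (\<lambda>i. M * W i) u (M * d) (\<lambda>x s. U x (s ^ M))"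
proof -
  have U: "poly4 U" using assms(1) by (simp add: homogenised_def)
  have "poly4 (\<lambda>x s. U x (s ^ M))"
    unfolding poly4_def by (rule poly4_compose[OF U]) auto
  moreover have "U (scale (\<lambda>i. M * W i) s x) (s ^ M) = s ^ (M * d) * u x" for s x
    unfolding scale_mult power_mult using assms(1) by (simp only: homogenised_def)
  moreover have "\<exists>x. U x (0 ^ M) \<noteq> 0"
    using assms unfolding homogenised_def zero_power[OF assms(2)] by blast
  ultimately show ?thesis unfolding homogenised_def by blast
qed

section \<open>Degenerating a one-parameter flow\<close>

text \<open>If \<open>c\<close> is the coefficient of \<open>t^m\<close> in the \<open>i\<close>-th component of the flow, its slope is
  \<open>(deg c - W i) / m\<close>. With the largest slope \<open>\<tau> / M\<close>, giving \<open>t\<close> the weight \<open>- \<tau> / M\<close> is what keeps the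
  limit finite and nontrivial; scaling \<open>W\<close> by \<open>M\<close> makes this weight an integer.\<close>
lemma degenerate_flow:
  fixes \<phi> :: "'a::field_char_0 pt3 \<Rightarrow> 'a \<Rightarrow> 'a pt3"
  assumes poly: "\<And>i. poly4 (\<lambda>x t. co i (\<phi> x t))" and zero: "\<And>x. \<phi> x 0 = x"
    and nontriv: "\<phi> z r \<noteq> z"
  obtains M X where "M > 0" "\<And>i. poly5 (\<lambda>x t s. co i (X x t s))"
    "\<And>x s t. s \<noteq> 0 \<Longrightarrow> \<exists>r. X (scale (\<lambda>i. M * W i) s x) t s = scale (\<lambda>i. M * W i) s (\<phi> x r)"
    "\<And>x s. X x 0 s = x" "\<exists>x t. X x t 0 \<noteq> x"
proof -
  have "\<exists>q D. (\<forall>m. pfun (\<lambda>y. coeff (q y) m)) \<and> (\<forall>y. degree (q y) \<le> D)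
    \<and> (\<forall>y r. co i (\<phi> (y 1, y 2, y 3) r) = poly (q y) r)" for i
    using pfun_coeffs[OF poly[of i, unfolded poly4_def]] by simp
  then obtain q E where q: "\<And>i m. pfun (\<lambda>y. coeff (q i y) m)" "\<And>i y. degree (q i y) \<le> E i"
    "\<And>i y r. co i (\<phi> (y 1, y 2, y 3) r) = poly (q i y) r"
    by metis
  define env :: "'a pt3 \<Rightarrow> nat \<Rightarrow> 'a" where "env x = (\<lambda>k. if k = 0 then 0 else co (k - 1) x)" for x
  define c where "c i m x = coeff (q i (env x)) m" for i m x
  define D where "D = E 0 + E 1 + E 2"
  have c_poly: "poly3 (c i m)" for i m
    unfolding poly3_def c_def env_def by (rule pfun_compose[OF q(1)]) auto
  have "(env x 1, env x 2, env x 3) = x" for x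
    by (simp add: env_def eval_nat_numeral co_def)
  then have q_env: "co i (\<phi> x t) = poly (q i (env x)) t" for i x t
    using q(3)[of i "env x" t] by simp
  have c0: "c i 0 x = co i x" for i x
    using q_env[of i x 0] zero by (simp add: c_def poly_0_coeff_0)
  have expand: "co i (\<phi> x t) = co i x + (\<Sum>m\<in>{1..D}. c i m x * t ^ m)" if "i < 3" for i x t
  proof -
    have "E i \<le> D" using that by (auto simp: D_def numeral_3_eq_3 numeral_2_eq_2 less_Suc_eq)
    then have "degree (q i (env x)) \<le> D" using q(2) le_trans by blast
    then have "co i (\<phi> x t) = (\<Sum>m\<le>D. c i m x * t ^ m)"
      unfolding q_env poly_altdef c_def
      by (intro sum.mono_neutral_left) (auto simp: coeff_eq_0)
    also have "{..D} = insert 0 {1..D}" by auto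
    finally show ?thesis by (simp add: c0)
  qed
  \<comment> \<open>The nonzero coefficients of positive powers of time; for \<open>m = 0\<close>
    the coefficient is the coordinate itself.\<close>
  define I where "I = {(i, m). i < 3 \<and> 1 \<le> m \<and> m \<le> D \<and> (\<exists>x. c i m x \<noteq> 0)}"
  have "finite I"
    by (rule finite_subset[of _ "{..<3} \<times> {1..D}"]) (auto simp: I_def)
  have "I \<noteq> {}"
  proof
    assume "I = {}"
    then have "c i m x = 0" if "i < 3" "m \<in> {1..D}" for i m x
      using that unfolding I_def by fastforce
    then have "\<phi> z r = z" by (intro pt3_eqI) (simp add: expand)
    then show False using nontriv by simp
  qed
  have "\<exists>d C. p \<in> I \<longrightarrow> homogenised W (c (fst p) (snd p)) d C" for p :: "nat \<times> nat"
  proof (cases "p \<in> I")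
    case True
    then obtain x where "c (fst p) (snd p) x \<noteq> 0" by (auto simp: I_def)
    then show ?thesis using homogenised_exists[OF c_poly] by metis
  qed blast
  then obtain d C where C: "\<And>p. p \<in> I \<Longrightarrow> homogenised W (c (fst p) (snd p)) (d p) (C p)"
    by metis
  define slope where "slope p = (of_int (int (d p) - int (W (fst p))) / of_nat (snd p) :: rat)" for p
  obtain p0 where p0: "p0 \<in> I" "\<And>p. p \<in> I \<Longrightarrow> slope p \<le> slope p0"
  proof -
    have "Max (slope ` I) \<in> slope ` I"
      using \<open>finite I\<close> \<open>I \<noteq> {}\<close> by (intro Max_in) auto
    then obtain p where "p \<in> I" "Max (slope ` I) = slope p" by blast
    moreover have "slope p' \<le> Max (slope ` I)" if "p' \<in> I" for p'
      using \<open>finite I\<close> that by (intro Max_ge) auto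
    ultimately show thesis using that by metis
  qed
  define M \<tau> where "M = snd p0" and "\<tau> = int (d p0) - int (W (fst p0))"
  have M: "M > 0" "M \<in> {1..D}" "fst p0 < 3" using p0(1) by (auto simp: I_def M_def)
  \<comment> \<open>The power of \<open>s\<close> left on the term \<open>p\<close> after scaling
    space and time. Maximality of the slope at \<open>p0\<close> makes the integer under
    \<open>nat\<close> nonnegative on \<open>I\<close>; at \<open>p0\<close> it is zero, so that
    term survives at \<open>s = 0\<close>.\<close>
  define e where "e p = nat (int (M * W (fst p)) - int (M * d p) + \<tau> * int (snd p))" for p
  have e: "int (e p) = int (M * W (fst p)) - int (M * d p) + \<tau> * int (snd p)" if "p \<in> I" for p
  proof -
    have "snd p > 0" using that by (auto simp: I_def)
    then have "rat_of_int (int (d p) - int (W (fst p))) * of_nat M \<le> of_int \<tau> * of_nat (snd p)"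
      using p0(2)[OF that] M(1) by (simp add: slope_def M_def \<tau>_def field_simps)
    then have "rat_of_int ((int (d p) - int (W (fst p))) * int M) \<le> of_int (\<tau> * int (snd p))"
      by simp
    then have "(int (d p) - int (W (fst p))) * int M \<le> \<tau> * int (snd p)"
      by (simp only: of_int_le_iff)
    then show ?thesis by (simp add: e_def algebra_simps)
  qed
  have e0: "e p0 = 0" by (simp add: e_def M_def \<tau>_def algebra_simps)
  define Y where "Y i x t s = co i x
      + (\<Sum>m\<in>{1..D}. if (i, m) \<in> I then s ^ e (i, m) * C (i, m) x (s ^ M) * t ^ m else 0)" for i x t s
  define X where "X x t s = (Y 0 x t s, Y 1 x t s, Y 2 x t s)" for x t s
  have X_co: "co i (X x t s) = Y i x t s" if "i < 3" for i x t s
    using that by (auto simp: X_def numeral_3_eq_3 numeral_2_eq_2 less_Suc_eq co_def)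
  have term_poly: "pfun (\<lambda>y. if (i, m) \<in> I then y 0 ^ e (i, m) * C (i, m) (y 2, y 3, y 4) (y 0 ^ M) * y 1 ^ m else 0)"
    for i m
  proof (cases "(i, m) \<in> I")
    case True
    then have "poly4 (C (i, m))" using C by (simp add: homogenised_def)
    from poly4_compose[OF this] have "pfun (\<lambda>y. C (i, m) (y 2, y 3, y 4) (y 0 ^ M))"
      by blast
    then have "pfun (\<lambda>y. y 0 ^ e (i, m) * C (i, m) (y 2, y 3, y 4) (y 0 ^ M) * y 1 ^ m)"
      by (intro pfun_mult pfun_power pfun_var)
    with True show ?thesis by simp
  qed auto
  have Y_poly: "pfun (\<lambda>y. Y i (y 2, y 3, y 4) (y 1) (y 0))" for i
    unfolding Y_def by (intro pfun_add pfun_co pfun_sum term_poly pfun_var)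
  have poly5_X: "poly5 (\<lambda>x t s. co i (X x t s))" for i
    unfolding poly5_def X_def by (intro pfun_co Y_poly)
  have scaled: "\<exists>r. X (scale (\<lambda>i. M * W i) s x) t s = scale (\<lambda>i. M * W i) s (\<phi> x r)"
    if s: "s \<noteq> 0" for x s t
  proof (intro exI pt3_eqI)
    fix i :: nat assume i: "i < 3"
    \<comment> \<open>The rescaled time; \<tau> may be negative, hence an integer power of the
      nonzero \<open>s\<close>.\<close>
    define r where "r = t * s powi \<tau>"
    have "(if (i, m) \<in> I then s ^ e (i, m) * C (i, m) (scale W (s ^ M) x) (s ^ M) * t ^ m else 0)
        = s ^ (M * W i) * (c i m x * r ^ m)" if m: "m \<in> {1..D}" for m
    proof (cases "(i, m) \<in> I")
      case True
      have "C (i, m) (scale W (s ^ M) x) (s ^ M) = s ^ (M * d (i, m)) * c i m x"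
        using C[OF True] by (simp add: homogenised_def power_mult del: split_paired_All)
      moreover have "s ^ e (i, m) * s ^ (M * d (i, m)) = s ^ (M * W i) * (s powi \<tau>) ^ m"
      proof -
        have "s ^ e (i, m) * s ^ (M * d (i, m)) = s powi (int (e (i, m)) + int (M * d (i, m)))"
          using s by (simp add: power_int_add del: of_nat_mult)
        also have "\<dots> = s powi (int (M * W i) + \<tau> * int m)"
          using e[OF True] by simp
        also have "\<dots> = s ^ (M * W i) * (s powi \<tau>) ^ m"
          using s by (simp add: power_int_add power_int_mult del: of_nat_mult)
        finally show ?thesis .
      qed
      ultimately have "s ^ e (i, m) * C (i, m) (scale W (s ^ M) x) (s ^ M) * t ^ m
          = s ^ (M * W i) * (s powi \<tau>) ^ m * c i m x * t ^ m"
        by (metis mult.assoc)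
      then show ?thesis using True
        by (simp only: r_def power_mult_distrib if_True mult_ac)
    next
      case False
      then have "c i m x = 0" using i m by (auto simp: I_def simp del: split_paired_Ex split_paired_All)
      then show ?thesis using False by simp
    qed
    then show "co i (X (scale (\<lambda>i. M * W i) s x) t s) = co i (scale (\<lambda>i. M * W i) s (\<phi> x (t * s powi \<tau>)))"
      unfolding X_co[OF i] Y_def co_scale[OF i] expand[OF i] scale_mult r_def[symmetric]
      by (simp add: co_scale[OF i] power_mult distrib_left sum_distrib_left)
  qed
  have X0: "X x 0 s = x" for x s
    by (rule pt3_eqI) (simp add: X_co Y_def power_0_left cong: if_cong)
  have "\<exists>x t. X x t 0 \<noteq> x"
  proof -
    \<comment> \<open>At this point the limit has a nonzero coefficient at \<open>t ^ M\<close>; the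
      other surviving terms of this component carry different powers of \<open>t\<close>.\<close>
    obtain x where x: "C p0 x 0 \<noteq> 0" using C[OF p0(1)] by (auto simp: homogenised_def)
    define a where "a m = (if (fst p0, m) \<in> I then 0 ^ e (fst p0, m) * C (fst p0, m) x (0 ^ M) else 0)" for m
    define P where "P = (\<Sum>m\<in>{1..D}. monom (a m) m)"
    have "coeff P M = a M"
      using M(2) by (simp add: P_def coeff_sum)
    also have "a M = C p0 x 0"
      using p0(1) e0 M(1) by (simp add: a_def M_def zero_power)
    finally have "P \<noteq> 0" using x by auto
    then obtain t where t: "poly P t \<noteq> 0"
      using poly_all_0_iff_0[of P] by blast
    have "co (fst p0) (X x t 0) - co (fst p0) x = poly P t"
      unfolding X_co[OF M(3)] Y_def P_def a_def
      by (auto simp: poly_sum poly_monom intro!: sum.cong)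
    then show ?thesis using t by (metis diff_self)
  qed
  with that M(1) poly5_X scaled X0 show ?thesis by blast
qed

lemma poly5_in_t:
  assumes "poly5 A"
  shows "\<exists>p. \<forall>t. A x t s = poly p t"
  using pfun_along_curve[OF assms[unfolded poly5_def],
      of "\<lambda>i. if i = 0 then [:s:] else if i = 1 then [:0, 1:] else [:co (i - 2) x:]"]
  by (simp add: eval_nat_numeral co_def)

text \<open>For nonzero \<open>s\<close>, the map \<open>X\<close> moves each point along the flow
  conjugated by \<open>scale W s\<close>, so invariance of \<open>u\<close> passes to
  \<open>U\<close>. Both sides are polynomial, which covers \<open>s = 0\<close>.\<close>

lemma homogenised_invariant:
  fixes u :: "'a::field_char_0 pt3 \<Rightarrow> 'a"
  assumes hom: "homogenised W u d U" and inv: "\<And>x t. u (\<phi> x t) = u x"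
    and X: "\<And>i. poly5 (\<lambda>x t s. co i (X x t s))"
      "\<And>x s t. s \<noteq> 0 \<Longrightarrow> \<exists>r. X (scale W s x) t s = scale W s (\<phi> x r)"
  shows "U (X x t s) s = U x s"
proof -
  have U: "poly4 U" "\<And>x s. U (scale W s x) s = s ^ d * u x"
    using hom unfolding homogenised_def by blast+
  have "(\<lambda>y :: nat \<Rightarrow> 'a. U (X (y 2, y 3, y 4) (y 1) (y 0)) (y 0)) = (\<lambda>y. U (y 2, y 3, y 4) (y 0))"
  proof (rule pfun_eq_if_eq_off_zero[where i = 0])
    have "pfun (\<lambda>y. U (co 0 (X (y 2, y 3, y 4) (y 1) (y 0)), co 1 (X (y 2, y 3, y 4) (y 1) (y 0)),
        co 2 (X (y 2, y 3, y 4) (y 1) (y 0))) (y 0))"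
      by (intro poly4_compose[OF U(1)] X(1)[unfolded poly5_def] pfun_var)
    then show "pfun (\<lambda>y. U (X (y 2, y 3, y 4) (y 1) (y 0)) (y 0))"
      by (simp add: co_def)
    show "pfun (\<lambda>y. U (y 2, y 3, y 4) (y 0))"
      by (intro poly4_compose[OF U(1)] pfun_var)
    fix y :: "nat \<Rightarrow> 'a" assume "y 0 \<noteq> 0"
    obtain z where z: "(y 2, y 3, y 4) = scale W (y 0) z"
      using scale_surj[OF \<open>y 0 \<noteq> 0\<close>] by metis
    obtain r where "X (scale W (y 0) z) (y 1) (y 0) = scale W (y 0) (\<phi> z r)"
      using X(2)[OF \<open>y 0 \<noteq> 0\<close>] by metis
    then show "U (X (y 2, y 3, y 4) (y 1) (y 0)) (y 0) = U (y 2, y 3, y 4) (y 0)"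
      using z U(2) inv by metis
  qed
  from fun_cong[OF this, of "\<lambda>i. if i = 0 then s else if i = 1 then t else co (i - 2) x"]
  show ?thesis by (simp add: eval_nat_numeral co_def)
qed

lemma poly_const_if_degree_0: "degree p = 0 \<Longrightarrow> poly p a = poly p b"
  by (elim degree_eq_zeroE) simp

lemma leading_form_indep:
  fixes u v :: "'a::field_char_0 pt3 \<Rightarrow> 'a"
  assumes hom_u: "homogenised W u d U" and hom_v: "homogenised W v d' V"
    and K: "poly3 K" "\<And>a b c. U (a, b, c) 0 = b * c * K (a, b, c)"
    and flow: "\<And>i. poly4 (\<lambda>x t. co i (\<phi> x t))" "\<And>x. \<phi> x 0 = x" "\<phi> z r \<noteq> z"
    and inv: "\<And>x t. u (\<phi> x t) = u x" "\<And>x t. v (\<phi> x t) = v x"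
  shows "V (a, b, c) 0 = V (0, b, c) 0"
proof -
  obtain M X where "M > 0" and X: "\<And>i. poly5 (\<lambda>x t s. co i (X x t s))"
    "\<And>x s t. s \<noteq> 0 \<Longrightarrow> \<exists>r. X (scale (\<lambda>i. M * W i) s x) t s = scale (\<lambda>i. M * W i) s (\<phi> x r)"
    "\<And>x s. X x 0 s = x" "\<exists>x t. X x t 0 \<noteq> x"
    using degenerate_flow[where \<phi> = \<phi> and W = W, OF flow] by blast
  have U_inv: "U (X x t 0) 0 = U x 0" and V_inv: "V (X x t 0) 0 = V x 0" for x t
    using homogenised_invariant[OF homogenised_mult[OF hom_u \<open>M > 0\<close>] inv(1) X(1,2), of x t 0]
      homogenised_invariant[OF homogenised_mult[OF hom_v \<open>M > 0\<close>] inv(2) X(1,2), of x t 0]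
      \<open>M > 0\<close> by (simp_all add: zero_power)
  have U: "poly4 U" and V: "poly4 V" using hom_u hom_v by (simp_all add: homogenised_def)
  obtain x0 where x0: "U x0 0 \<noteq> 0" using hom_u unfolding homogenised_def by blast
  have X_poly: "pfun (\<lambda>y. co i (X (A y, B y, C y) (T y) 0))"
    if "pfun A" "pfun B" "pfun C" "pfun T" for i and A B C T :: "(nat \<Rightarrow> 'a) \<Rightarrow> 'a"
    using poly5_compose[OF X(1) that pfun_const[of 0]] .
  have fixed: "fst (snd (X x t 0)) = fst (snd x) \<and> snd (snd (X x t 0)) = snd (snd x)"
    if "U x 0 \<noteq> 0" for x t
  proof -
    have "poly5 (\<lambda>x t s. K (X x t s))"
      using poly3_compose[OF K(1) X(1)[of 0, unfolded poly5_def] X(1)[of 1, unfolded poly5_def]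
          X(1)[of 2, unfolded poly5_def]] by (simp add: poly5_def)
    then obtain k where k: "\<And>t. K (X x t 0) = poly k t" using poly5_in_t by metis
    obtain p where p: "\<And>t. co 1 (X x t 0) = poly p t" using poly5_in_t[OF X(1)] by metis
    obtain q where q: "\<And>t. co 2 (X x t 0) = poly q t" using poly5_in_t[OF X(1)] by metis
    \<comment> \<open>Along \<open>t\<close>, the product of \<open>X_2\<close>, \<open>X_3\<close>
      and \<open>K\<close> of \<open>X\<close> is the nonzero constant \<open>U x 0\<close>, so
      every factor has degree 0.\<close>
    have "poly (p * q * k) = poly [:U x 0:]"
    proof
      fix t
      have "poly (p * q * k) t = U (X x t 0) 0"
        using K(2)[of "fst (X x t 0)" "fst (snd (X x t 0))" "snd (snd (X x t 0))"]
        by (simp flip: p q k)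
      then show "poly (p * q * k) t = poly [:U x 0:] t" by (simp add: U_inv)
    qed
    then have "p * q * k = [:U x 0:]" by (simp only: poly_eq_poly_eq_iff)
    moreover from this have "p \<noteq> 0" "q \<noteq> 0" "k \<noteq> 0" using that by auto
    ultimately have "degree p + degree q + degree k = degree [:U x 0:]"
      by (metis degree_mult_eq mult_eq_0_iff)
    then have "degree p = 0" "degree q = 0" by simp_all
    then have "poly p t = poly p 0" "poly q t = poly q 0"
      by (simp_all add: poly_const_if_degree_0[of _ t 0])
    then show ?thesis using p[of t] p[of 0] q[of t] q[of 0] X(3) by simp
  qed
  \<comment> \<open>Density of the locus where \<open>U x 0\<close> is nonzero extends
    \<open>fixed\<close> to all points.\<close>
  have fix_i: "co i (X x t 0) = co i x" if i: "i \<in> {1, 2}" for i x t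
  proof -
    define env where "env x t = (\<lambda>k. if k = (0::nat) then t else co (k - 1) x)" for x and t :: 'a
    have "co i (X (env x t 1, env x t 2, env x t 3) (env x t 0) 0) - co i (env x t 1, env x t 2, env x t 3) = 0"
    proof (rule pfun_no_zero_divisors[where P = "\<lambda>y. U (y 1, y 2, y 3) 0" and a = "env x0 0"
          and Q = "\<lambda>y. co i (X (y 1, y 2, y 3) (y 0) 0) - co i (y 1, y 2, y 3)" and b = "env x t"])
      show "pfun (\<lambda>y. U (y 1, y 2, y 3) 0)"
        by (rule poly4_compose[OF U]) blast+
      show "pfun (\<lambda>y. co i (X (y 1, y 2, y 3) (y 0) 0) - co i (y 1, y 2, y 3))"
        by (intro pfun_diff X_poly pfun_co pfun_var)
      show "U (y 1, y 2, y 3) 0 * (co i (X (y 1, y 2, y 3) (y 0) 0) - co i (y 1, y 2, y 3)) = 0"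
        for y :: "nat \<Rightarrow> 'a"
        using fixed[of "(y 1, y 2, y 3)" "y 0"] i by (cases "U (y 1, y 2, y 3) 0 = 0") auto
      show "U (env x0 0 1, env x0 0 2, env x0 0 3) 0 \<noteq> 0"
        using x0 by (simp add: env_def eval_nat_numeral co_def)
    qed
    then show ?thesis by (simp add: env_def eval_nat_numeral co_def)
  qed
  have X_eq: "X x t 0 = (fst (X x t 0), fst (snd x), snd (snd x))" for x t
    using fix_i[of 1 x t] fix_i[of 2 x t] by (simp add: prod_eq_iff)
  \<comment> \<open>On the line in direction \<open>x_1\<close>, \<open>V\<close> is constant along
    the nonconstant polynomial \<open>p\<close>; degrees multiply under composition, so
    \<open>V\<close> is constant on the line.\<close>
  have moved: "V (a, b, c) 0 = V (0, b, c) 0" if "fst (X (a, b, c) t 0) \<noteq> a" for a b c t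
  proof -
    obtain p where p: "\<And>t. co 0 (X (a, b, c) t 0) = poly p t" using poly5_in_t[OF X(1)] by metis
    obtain q where q: "\<And>r. V (r, b, c) 0 = poly q r"
      using pfun_along_curve[OF V[unfolded poly4_def],
          of "\<lambda>i. if i = 0 then 0 else if i = 1 then [:0, 1:] else if i = 2 then [:b:] else [:c:]"]
      by auto
    have "poly (pcompose q p) = poly [:V (a, b, c) 0:]"
    proof
      fix t
      have "V (poly p t, b, c) 0 = V (a, b, c) 0"
        using V_inv[of "(a, b, c)" t] X_eq[of "(a, b, c)" t] p[of t] by simp
      then show "poly (pcompose q p) t = poly [:V (a, b, c) 0:] t"
        by (simp add: poly_pcompose q)
    qed
    then have "pcompose q p = [:V (a, b, c) 0:]"
      by (simp only: poly_eq_poly_eq_iff)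
    then have "degree q * degree p = 0" by (metis degree_pcompose degree_pCons_0)
    moreover have "degree p \<noteq> 0"
    proof
      assume "degree p = 0"
      then have "poly p t = poly p 0" by (rule poly_const_if_degree_0)
      then show False using p[of t] p[of 0] X(3) that by simp
    qed
    ultimately have "degree q = 0" by simp
    then show ?thesis unfolding q by (rule poly_const_if_degree_0)
  qed
  obtain x1 t1 where x1: "fst (X x1 t1 0) \<noteq> fst x1"
    using X(4) X_eq by (metis prod.collapse)
  define env where "env x t = (\<lambda>k. if k = (0::nat) then t else co (k - 1) x)" for x and t :: 'a
  let ?e = "env (a, b, c) 0"
  \<comment> \<open>A single moved point makes the displacement of \<open>x_1\<close> a nonzero
    polynomial, so \<open>moved\<close> extends to all points by density.\<close>
  have "V (?e 1, ?e 2, ?e 3) 0 - V (0, ?e 2, ?e 3) 0 = 0"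
  proof (rule pfun_no_zero_divisors[where P = "\<lambda>y. co 0 (X (y 1, y 2, y 3) (y 0) 0) - y 1" and a = "env x1 t1"
        and Q = "\<lambda>y. V (y 1, y 2, y 3) 0 - V (0, y 2, y 3) 0" and b = ?e])
    show "pfun (\<lambda>y. co 0 (X (y 1, y 2, y 3) (y 0) 0) - y 1)"
      by (intro pfun_diff X_poly pfun_var)
    show "pfun (\<lambda>y. V (y 1, y 2, y 3) 0 - V (0, y 2, y 3) 0)"
      by (intro pfun_diff poly4_compose[OF V] pfun_var pfun_const)
    show "(co 0 (X (y 1, y 2, y 3) (y 0) 0) - y 1) * (V (y 1, y 2, y 3) 0 - V (0, y 2, y 3) 0) = 0"
      for y :: "nat \<Rightarrow> 'a"
      using moved[of "y 1" "y 2" "y 3" "y 0"] by auto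
    show "co 0 (X (env x1 t1 1, env x1 t1 2, env x1 t1 3) (env x1 t1 0) 0) - env x1 t1 1 \<noteq> 0"
      using x1 by (simp add: env_def eval_nat_numeral co_def)
  qed
  then show ?thesis by (simp add: env_def eval_nat_numeral co_def)
qed

section \<open>Forward polynomials\<close>

text \<open>For positive weights, \<open>d > 0\<close> excludes constants and makes the leading form
  vanish at the origin.\<close>

definition forward :: "(nat \<Rightarrow> nat) \<Rightarrow> ('a::comm_ring_1 pt3 \<Rightarrow> 'a) \<Rightarrow> bool" where
  "forward W u \<longleftrightarrow> (\<exists>d U. homogenised W u d U \<and> d > 0 \<and> (\<forall>a b c. U (a, b, c) 0 = U (0, b, c) 0))"

text \<open>The inequality lets \<open>x_2 x_3\<close> dominate \<open>x_1\<close> in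
  \<open>x_1 + x_2 x_3\<close>.\<close>

definition admissible :: "(nat \<Rightarrow> nat) \<Rightarrow> bool" where
  "admissible W \<longleftrightarrow> (\<forall>i. W i > 0) \<and> W 0 < W 1 + W 2"

text \<open>The weights of the leading forms \<open>x\<^sub>3\<close>, \<open>x\<^sub>2 x\<^sub>3^(n-1)\<close> and \<open>x\<^sub>2 x\<^sub>3^n\<close>
  of the three components of \<open>f\<close> inverse.\<close>
definition next_weight :: "nat \<Rightarrow> (nat \<Rightarrow> nat) \<Rightarrow> nat \<Rightarrow> nat" where
  "next_weight n W = (\<lambda>i. if i = 0 then W 2 else if i = 1 then W 1 + (n - 1) * W 2 else W 1 + n * W 2)"

lemma admissible_next_weight: "n > 0 \<Longrightarrow> admissible W \<Longrightarrow> admissible (next_weight n W)"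
  by (cases n) (auto simp: admissible_def next_weight_def)

lemma admissible_funpow_next_weight: "n > 0 \<Longrightarrow> admissible ((next_weight n ^^ j) (\<lambda>_. 1))"
  by (induction j) (auto simp: admissible_next_weight, simp add: admissible_def)

lemma forward_third_coordinate: "admissible W \<Longrightarrow> forward W (\<lambda>x :: 'a::comm_ring_1 pt3. snd (snd x))"
  unfolding forward_def homogenised_def
  by (intro exI[of _ "W 2"] exI[of _ "\<lambda>x s. snd (snd x)"])
     (auto simp: poly4_def scale_def admissible_def intro: exI[of _ 1])

text \<open>The leading form is \<open>a x_1\<close>. Since \<open>forward\<close> allows any
  homogenisation, every \<open>d\<close> is treated: \<open>d < W 0\<close> contradicts
  polynomiality of \<open>U\<close>, and \<open>d > W 0\<close> makes \<open>U\<close> vanish at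
  \<open>s = 0\<close>.\<close>

lemma not_forward_first_coordinate:
  fixes a c :: "'a::field_char_0"
  assumes "a \<noteq> 0" "W 0 > 0"
  shows "\<not> forward W (\<lambda>x. a * fst x + c)"
proof
  assume "forward W (\<lambda>x. a * fst x + c)"
  then obtain d U where U: "poly4 U" "\<And>x s. U (scale W s x) s = s ^ d * (a * fst x + c)"
    "\<exists>x. U x 0 \<noteq> 0" and indep: "\<And>y1 y2 y3. U (y1, y2, y3) 0 = U (0, y2, y3) 0"
    unfolding forward_def homogenised_def by blast
  have eq: "U y s * s ^ W 0 = s ^ d * (a * fst y + c * s ^ W 0)" if s: "s \<noteq> 0" for y s
  proof -
    obtain x where x: "y = scale W s x" using scale_surj[OF s] by metis
    then have "fst y = s ^ W 0 * fst x" by (simp add: scale_def)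
    then show ?thesis unfolding x U(2) by (simp add: algebra_simps)
  qed
  have U_poly: "pfun (\<lambda>y. U (y 1, y 2, y 3) (y 0))"
    using U(1) by (simp only: poly4_def)
  show False
  proof (cases "d < W 0")
    case True
    have "(\<lambda>y :: nat \<Rightarrow> 'a. U (y 1, y 2, y 3) (y 0) * y 0 ^ (W 0 - d)) = (\<lambda>y. a * y 1 + c * y 0 ^ W 0)"
    proof (rule pfun_eq_if_eq_off_zero[where i = 0])
      fix y :: "nat \<Rightarrow> 'a" assume y: "y 0 \<noteq> 0"
      have "y 0 ^ d * (U (y 1, y 2, y 3) (y 0) * y 0 ^ (W 0 - d)) = U (y 1, y 2, y 3) (y 0) * y 0 ^ W 0"
        using True by (simp add: mult_ac flip: power_add)
      also have "\<dots> = y 0 ^ d * (a * y 1 + c * y 0 ^ W 0)"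
        using eq[OF y] by simp
      finally show "U (y 1, y 2, y 3) (y 0) * y 0 ^ (W 0 - d) = a * y 1 + c * y 0 ^ W 0"
        using y by simp
    qed (intro pfun_mult pfun_add pfun_power pfun_const pfun_var U_poly)+
    from fun_cong[OF this, of "\<lambda>i. if i = 0 then 0 else 1"] show False
      using assms True by (simp add: zero_power)
  next
    case False
    have "(\<lambda>y :: nat \<Rightarrow> 'a. U (y 1, y 2, y 3) (y 0)) = (\<lambda>y. y 0 ^ (d - W 0) * (a * y 1 + c * y 0 ^ W 0))"
    proof (rule pfun_eq_if_eq_off_zero[where i = 0])
      fix y :: "nat \<Rightarrow> 'a" assume y: "y 0 \<noteq> 0"
      have "U (y 1, y 2, y 3) (y 0) * y 0 ^ W 0 = y 0 ^ d * (a * y 1 + c * y 0 ^ W 0)"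
        using eq[OF y] by simp
      also have "y 0 ^ d = y 0 ^ (d - W 0) * y 0 ^ W 0"
        using False by (simp flip: power_add)
      finally show "U (y 1, y 2, y 3) (y 0) = y 0 ^ (d - W 0) * (a * y 1 + c * y 0 ^ W 0)"
        using y by simp
    qed (intro pfun_mult pfun_add pfun_power pfun_const pfun_var U_poly)+
    from fun_cong[OF this, of "\<lambda>i. if i = 0 then 0 else co (i - 1) _"]
    have U0: "U y 0 = 0 ^ (d - W 0) * (a * fst y)" for y
      using assms(2) by (simp add: eval_nat_numeral co_def)
    show False
      using U(3) indep[of 1 0 0] assms(1) unfolding U0 by (auto simp: power_0_left split: if_splits)
  qed
qed

section \<open>Iterates of \<open>g_inv_map\<close> and their leading forms\<close>

fun g_iter :: "nat \<Rightarrow> 'a::comm_ring_1 pt3 \<Rightarrow> 'a" where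
  "g_iter 0 x = fst x"
| "g_iter (Suc 0) x = fst (snd x)"
| "g_iter (Suc (Suc m)) x = g_iter m x + g_iter (Suc m) x * snd (snd x)"

lemma g_inv_map_funpow: "(g_inv_map ^^ m) x = (g_iter m x, g_iter (Suc m) x, snd (snd x))"
  by (induction m) (simp_all add: g_inv_map_def)

text \<open>Homogenises \<open>g_iter (Suc m)\<close>, in degree \<open>W 1 + m * W 2\<close>; the
  shift skips \<open>g_iter 0 = x_1\<close>. The powers of \<open>s\<close> compensate the degree
  gaps between the two summands.\<close>

fun g_iter_hom :: "(nat \<Rightarrow> nat) \<Rightarrow> nat \<Rightarrow> 'a::comm_ring_1 pt3 \<Rightarrow> 'a \<Rightarrow> 'a" where
  "g_iter_hom W 0 x s = fst (snd x)"
| "g_iter_hom W (Suc 0) x s = fst (snd x) * snd (snd x) + s ^ (W 1 + W 2 - W 0) * fst x"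
| "g_iter_hom W (Suc (Suc m)) x s = g_iter_hom W (Suc m) x s * snd (snd x) + s ^ (2 * W 2) * g_iter_hom W m x s"

lemma g_iter_hom_scale:
  assumes "admissible W"
  shows "g_iter_hom W m (scale W s x) s = s ^ (W 1 + m * W 2) * g_iter (Suc m) x"
proof (induction m rule: induct_nat_012)
  case 1
  have "s ^ (W 1 + W 2) = s ^ (W 1 + W 2 - W 0) * s ^ W 0"
    using assms by (simp add: admissible_def flip: power_add)
  then show ?case by (simp add: scale_def power_add algebra_simps)
next
  case (ge2 m)
  then show ?case
    by (simp add: scale_def power_add power_mult power2_eq_square algebra_simps)
qed (simp add: scale_def)

lemma g_iter_hom_0:
  assumes "admissible W"
  shows "g_iter_hom W m x 0 = fst (snd x) * snd (snd x) ^ m"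
proof (induction m rule: induct_nat_012)
  case 1
  have "W 1 + W 2 - W 0 > 0" using assms by (simp add: admissible_def)
  then show ?case by (simp add: zero_power)
next
  case (ge2 m)
  have "2 * W 2 > 0" using assms by (simp add: admissible_def)
  then show ?case using ge2 by (simp add: zero_power)
qed simp

lemma pfun_g_iter_hom:
  assumes "pfun A" "pfun B" "pfun C" "pfun D"
  shows "pfun (\<lambda>y. g_iter_hom W m (A y, B y, C y) (D y))"
proof (induction m rule: induct_nat_012)
  case (ge2 m)
  show ?case unfolding g_iter_hom.simps snd_conv
    by (intro pfun_add pfun_mult pfun_power ge2 assms)
qed (use assms in auto)

text \<open>One step of \<open>f\<close> makes the leading form of a forward polynomial divisible by \<open>x\<^sub>2 x\<^sub>3\<close>,
  which divides both \<open>x\<^sub>2 x\<^sub>3^(n-1)\<close> and \<open>x\<^sub>2 x\<^sub>3^n\<close>.\<close>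
lemma forward_step:
  fixes v :: "'a::field_char_0 pt3 \<Rightarrow> 'a"
  assumes n: "n \<ge> 2" and W: "admissible W" and v: "forward (next_weight n W) v"
  obtains d U K where "homogenised W (\<lambda>x. v ((h_inv_map \<circ> g_inv_map ^^ n) x)) d U" "poly3 K"
    "\<And>a b c. U (a, b, c) 0 = b * c * K (a, b, c)"
proof -
  let ?W = "next_weight n W"
  obtain d V where hom: "homogenised ?W v d V" and "d > 0"
    and indep: "\<And>a b c. V (a, b, c) 0 = V (0, b, c) 0"
    using v unfolding forward_def by blast
  then have V: "poly4 V" "\<And>x s. V (scale ?W s x) s = s ^ d * v x"
    unfolding homogenised_def by blast+
  have "admissible ?W" using n W by (intro admissible_next_weight) auto
  then have V_origin: "V (0, 0, 0) 0 = 0"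
    using homogenised_origin[OF hom _ \<open>d > 0\<close>] by (simp add: admissible_def)
  \<comment> \<open>\<open>V\<close> is composed with the homogenised components of the map; at
    \<open>s = 0\<close> these become the monomials \<open>x_3\<close>,
    \<open>x_2 x_3^(n-1)\<close>, \<open>x_2 x_3^n\<close>.\<close>
  define U where "U x s = V (snd (snd x), g_iter_hom W (n - 1) x s, g_iter_hom W n x s) s" for x s
  have "poly4 U"
    unfolding poly4_def U_def snd_conv by (intro poly4_compose[OF V(1)] pfun_g_iter_hom pfun_var)
  moreover have "U (scale W s x) s = s ^ d * v ((h_inv_map \<circ> g_inv_map ^^ n) x)" for x s
  proof -
    have "(snd (snd (scale W s x)), g_iter_hom W (n - 1) (scale W s x) s, g_iter_hom W n (scale W s x) s)
        = scale ?W s ((h_inv_map \<circ> g_inv_map ^^ n) x)"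
      unfolding g_iter_hom_scale[OF W] using n
      by (simp add: g_inv_map_funpow h_inv_map_def) (simp add: scale_def next_weight_def)
    then show ?thesis unfolding U_def by (simp only: V(2))
  qed
  moreover have U0: "U (a, b, c) 0 = V (0, b * c ^ (n - 1), b * c ^ n) 0" for a b c
    using indep[of c] by (simp add: U_def g_iter_hom_0[OF W])
  moreover have "\<exists>x. U x 0 \<noteq> 0"
  proof -
    obtain a' b' c' where nz: "V (a', b', c') 0 \<noteq> 0"
      using hom unfolding homogenised_def by auto
    have "\<exists>b c. b * c \<noteq> 0 \<and> V (0, b, c) 0 \<noteq> 0"
    proof (rule ccontr)
      assume none: "\<not> ?thesis"
      let ?e = "\<lambda>i::nat. if i = 0 then b' else c'"
      have "V (0, ?e 0, ?e 1) 0 = 0"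
        by (rule pfun_no_zero_divisors[where P = "\<lambda>y. y 0 * y 1" and a = "\<lambda>_. 1"
              and Q = "\<lambda>y. V (0, y 0, y 1) 0" and b = ?e])
           (use none in \<open>auto intro: poly4_compose[OF V(1)]\<close>)
      then show False using nz indep[of a' b' c'] by simp
    qed
    then obtain b c where bc: "b \<noteq> 0" "c \<noteq> 0" "V (0, b, c) 0 \<noteq> 0" by auto
    \<comment> \<open>This point solves \<open>x_2 x_3^(n-1) = b\<close> and
      \<open>x_2 x_3^n = c\<close>: the quotient of the equations gives
      \<open>x_3 = c / b\<close>.\<close>
    have "b / (c / b) ^ (n - 1) * (c / b) ^ (n - 1) = b"
      using bc by simp
    moreover have "b / (c / b) ^ (n - 1) * (c / b) ^ n = c"
      using bc n by (cases n) auto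
    ultimately have "U (0, b / (c / b) ^ (n - 1), c / b) 0 \<noteq> 0"
      using bc(3) by (simp only: U0) simp
    then show ?thesis by blast
  qed
  ultimately have "homogenised W (\<lambda>x. v ((h_inv_map \<circ> g_inv_map ^^ n) x)) d U"
    unfolding homogenised_def by blast
  \<comment> \<open>\<open>V\<close> at \<open>s = 0\<close> vanishes at the origin, so
    \<open>y 0\<close> divides the restricted form. Later \<open>y 0 = x_2 x_3\<close>, with
    cofactors \<open>x_3^(n-2)\<close> and \<open>x_3^(n-1)\<close>, using
    \<open>n \<ge> 2\<close>.\<close>
  moreover have "\<exists>R. pfun R \<and> (\<forall>y. V (0, y 0 * y 1, y 0 * y 2) 0 = y 0 * R y)"
  proof -
    have "pfun (\<lambda>y. V (0, y 0 * y 1, y 0 * y 2) 0)"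
      by (intro poly4_compose[OF V(1)] pfun_mult pfun_var pfun_const)
    from pfun_split_at_zero[OF this] show ?thesis using V_origin by simp
  qed
  then obtain R where R: "pfun R" "\<And>y. V (0, y 0 * y 1, y 0 * y 2) 0 = y 0 * R y" by blast
  define K where "K x = R (\<lambda>i. if i = 0 then fst (snd x) * snd (snd x)
      else if i = 1 then snd (snd x) ^ (n - 2) else snd (snd x) ^ (n - 1))" for x :: "'a pt3"
  have "poly3 K"
    unfolding poly3_def K_def fst_conv snd_conv by (rule pfun_compose[OF R(1)]) auto
  moreover have "U (a, b, c) 0 = b * c * K (a, b, c)" for a b c
  proof -
    obtain m where m: "n = Suc (Suc m)" using n by (metis add_2_eq_Suc le_Suc_ex)
    show ?thesis
      using R(2)[of "\<lambda>i. if i = 0 then b * c else if i = 1 then c ^ (n - 2) else c ^ (n - 1)"]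
      unfolding U0 K_def fst_conv snd_conv m by (simp add: mult_ac)
  qed
  ultimately show ?thesis using that by blast
qed

section \<open>Polynomial automorphisms\<close>

definition polymap :: "('a::comm_ring_1 pt3 \<Rightarrow> 'a pt3) \<Rightarrow> bool" where
  "polymap F \<longleftrightarrow> (\<forall>i. poly3 (\<lambda>x. co i (F x)))"

definition polyaut :: "('a::comm_ring_1 pt3 \<Rightarrow> 'a pt3) \<Rightarrow> bool" where
  "polyaut F \<longleftrightarrow> polymap F \<and> bij F \<and> polymap (inv F)"

lemma polymap_compose_pfun:
  assumes "polymap F" "pfun A" "pfun B" "pfun C"
  shows "pfun (\<lambda>y. co i (F (A y, B y, C y)))"
  using poly3_compose[OF _ assms(2-4), of "\<lambda>x. co i (F x)"] assms(1) by (simp add: polymap_def)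

lemma polymap_comp:
  assumes "polymap F" "polymap G"
  shows "polymap (F \<circ> G)"
proof -
  have "pfun (\<lambda>y. co j (G (y 0, y 1, y 2)))" for j
    using assms(2) by (simp only: polymap_def poly3_def)
  then have "pfun (\<lambda>y. co i (F (co 0 (G (y 0, y 1, y 2)), co 1 (G (y 0, y 1, y 2)), co 2 (G (y 0, y 1, y 2)))))" for i
    by (intro polymap_compose_pfun[OF assms(1)])
  then show ?thesis by (simp add: polymap_def poly3_def)
qed

lemma polymap_id: "polymap id"
  by (auto simp: polymap_def poly3_def)

lemma polyaut_id: "polyaut id"
  by (simp add: polyaut_def polymap_id)

lemma polyaut_comp: "polyaut F \<Longrightarrow> polyaut G \<Longrightarrow> polyaut (F \<circ> G)"
  by (simp add: polyaut_def polymap_comp bij_comp o_inv_distrib)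

lemma polyaut_inv: "polyaut F \<Longrightarrow> polyaut (inv F)"
  by (simp add: polyaut_def bij_imp_bij_inv inv_inv_eq)

lemma polyaut_funpow: "polyaut F \<Longrightarrow> polyaut (F ^^ k)"
  by (induction k) (auto simp: polyaut_id[unfolded id_def] polyaut_id intro: polyaut_comp)

lemma polyautI:
  assumes "polymap F" "polymap G" "\<And>x. G (F x) = x" "\<And>x. F (G x) = x"
  shows "polyaut F"
proof -
  have "inv F = G" using assms(3,4) by (intro inv_unique_comp) (auto simp: fun_eq_iff)
  moreover have "bij F" using assms(3,4) by (metis bijI')
  ultimately show ?thesis using assms by (simp add: polyaut_def)
qed

text \<open>The flow is \<open>\<Theta>\<close> followed by translation along a vector killed by the linear parts of both
  affine forms, followed by \<open>\<Theta>\<close> inverse.\<close>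
lemma forward_neighbour:
  fixes u :: "'a::field_char_0 pt3 \<Rightarrow> 'a"
  assumes n: "n \<ge> 2" and W: "admissible W" and u: "forward (next_weight n W) u"
    and \<Theta>: "polyaut \<Theta>"
    and comb: "\<And>x. u ((h_inv_map \<circ> g_inv_map ^^ n) x)
      = a * fst (\<Theta> x) + b * fst (snd (\<Theta> x)) + c * snd (snd (\<Theta> x)) + e"
  shows "forward W (\<lambda>x. fst (\<Theta> x))"
proof -
  let ?u = "\<lambda>x. u ((h_inv_map \<circ> g_inv_map ^^ n) x)" and ?v = "\<lambda>x. fst (\<Theta> x)"
  obtain d U K where U: "homogenised W ?u d U" "poly3 K" "\<And>a b c. U (a, b, c) 0 = b * c * K (a, b, c)"
    using forward_step[OF n W u] by blast
  have inv: "\<Theta> (inv \<Theta> y) = y" "inv \<Theta> (\<Theta> y) = y" for y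
    using \<Theta> by (auto simp: polyaut_def bij_def surj_f_inv_f)
  have "poly3 (\<lambda>x. co 0 (\<Theta> x))"
    using \<Theta> unfolding polyaut_def polymap_def by blast
  then have v_poly: "poly3 ?v" by simp
  have v01: "?v (inv \<Theta> (0, 0, 0)) = 0" "?v (inv \<Theta> (1, 0, 0)) = 1" by (simp_all add: inv)
  then have "?v (inv \<Theta> (1, 0, 0)) \<noteq> 0" by simp
  from homogenised_exists[OF v_poly this] obtain d' V where V: "homogenised W ?v d' V" .
  have "d' > 0"
    using homogenised_degree_pos[OF V, of "inv \<Theta> (0, 0, 0)" "inv \<Theta> (1, 0, 0)"] W v01
    by (simp add: admissible_def)
  \<comment> \<open>In the coordinates \<Theta>, translation along \<open>(0, p, q)\<close> fixes
    the first coordinate, and one linear equation in two unknowns makes it preserve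
    \<open>?u\<close> too.\<close>
  obtain p q where pq: "b * p + c * q = 0" "(p, q) \<noteq> (0, 0)"
  proof (cases "b = 0 \<and> c = 0")
    case True
    then show thesis using that[of 1 0] by simp
  next
    case False
    then show thesis using that[of c "- b"] by auto
  qed
  define \<phi> where "\<phi> x t = inv \<Theta> (fst (\<Theta> x), fst (snd (\<Theta> x)) + t * p, snd (snd (\<Theta> x)) + t * q)" for x t
  have "poly4 (\<lambda>x t. co i (\<phi> x t))" for i
  proof -
    have \<Theta>_poly: "pfun (\<lambda>y. co j (\<Theta> (y 1, y 2, y 3)))" for j
      using \<Theta> by (intro polymap_compose_pfun pfun_var) (simp add: polyaut_def)
    have "pfun (\<lambda>y. co i (inv \<Theta> (co 0 (\<Theta> (y 1, y 2, y 3)), co 1 (\<Theta> (y 1, y 2, y 3)) + y 0 * p,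
        co 2 (\<Theta> (y 1, y 2, y 3)) + y 0 * q)))"
      using \<Theta> by (intro polymap_compose_pfun pfun_add pfun_mult \<Theta>_poly pfun_var pfun_const)
        (simp add: polyaut_def)
    then show ?thesis by (simp add: poly4_def \<phi>_def)
  qed
  moreover have "\<phi> x 0 = x" for x by (simp add: \<phi>_def inv)
  moreover have "\<phi> (inv \<Theta> (0, 0, 0)) 1 \<noteq> inv \<Theta> (0, 0, 0)"
  proof
    assume "\<phi> (inv \<Theta> (0, 0, 0)) 1 = inv \<Theta> (0, 0, 0)"
    then have "inv \<Theta> (0, p, q) = inv \<Theta> (0, 0, 0)" by (simp add: \<phi>_def inv)
    then show False using pq(2) by (metis inv(1) prod.inject)
  qed
  moreover have "?u (\<phi> x t) = ?u x" for x t
  proof -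
    have "b * (t * p) + c * (t * q) = 0"
      using arg_cong[OF pq(1), of "\<lambda>z. t * z"] by (simp add: algebra_simps)
    then show ?thesis unfolding comb by (simp add: \<phi>_def inv algebra_simps)
  qed
  moreover have "?v (\<phi> x t) = ?v x" for x t by (simp add: \<phi>_def inv)
  ultimately have "V (a, b, c) 0 = V (0, b, c) 0" for a b c
    by (rule leading_form_indep[OF U(1) V U(2,3)])
  then show ?thesis unfolding forward_def using V \<open>d' > 0\<close> by blast
qed

section \<open>Tame maps as polynomial automorphisms, and the tame group\<close>

lemma polyfun2_compose:
  assumes "polyfun2 P" "pfun A" "pfun B"
  shows "pfun (\<lambda>y. P (A y, B y))"
  using assms(1)
proof (induction rule: polyfun2.induct)
  case pf2_fst
  then show ?case using assms(2) by simp
next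
  case pf2_snd
  then show ?case using assms(3) by simp
qed auto

lemma polyaut_elem3:
  assumes "F \<in> elem3"
  shows "polyaut F"
proof -
  obtain P where P: "polyfun2 P" and F: "F = (\<lambda>(x1, x2, x3). (x1 + P (x2, x3), x2, x3))"
    using assms by (auto simp: elem3_def)
  have pP: "pfun (\<lambda>y. P (y 1, y 2))"
    by (rule polyfun2_compose[OF P]) auto
  show ?thesis
  proof (rule polyautI[where G = "\<lambda>(x1, x2, x3). (x1 - P (x2, x3), x2, x3)"])
    show "polymap F"
      unfolding polymap_def poly3_def F prod.case by (intro allI pfun_co pfun_add pP pfun_var)
    show "polymap (\<lambda>(x1, x2, x3). (x1 - P (x2, x3), x2, x3))"
      unfolding polymap_def poly3_def prod.case by (intro allI pfun_co pfun_diff pP pfun_var)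
  qed (auto simp: F)
qed

lemma row_times_matrix:
  fixes n0 :: "'a::comm_ring_1"
  assumes "n0 * m00 + n1 * m10 + n2 * m20 = e0" "n0 * m01 + n1 * m11 + n2 * m21 = e1"
    "n0 * m02 + n1 * m12 + n2 * m22 = e2"
  shows "n0 * (m00 * x + m01 * y + m02 * z) + n1 * (m10 * x + m11 * y + m12 * z)
    + n2 * (m20 * x + m21 * y + m22 * z) = e0 * x + e1 * y + e2 * z"
  unfolding assms[symmetric] by (simp add: algebra_simps)

lemma sum_less_3: "(\<Sum>l<3. a l) = a 0 + a 1 + a (2::nat)"
  by (simp add: numeral_3_eq_3 numeral_2_eq_2)

lemma polyaut_affine3:
  assumes "F \<in> affine3"
  shows "polyaut F"
proof -
  obtain M c where M: "invertible_mat 3 M" and F: "F = (\<lambda>(x1, x2, x3).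
        (M 0 0 * x1 + M 0 1 * x2 + M 0 2 * x3 + c 0,
         M 1 0 * x1 + M 1 1 * x2 + M 1 2 * x3 + c 1,
         M 2 0 * x1 + M 2 1 * x2 + M 2 2 * x3 + c (2::nat)))"
    using assms by (auto simp: affine3_def)
  obtain N where "\<forall>i<3. \<forall>j<3. (\<Sum>l<3. N i l * M l j) = (if i = j then 1 else 0) \<and>
      (\<Sum>l<3. M i l * N l j) = (if i = j then 1 else 0)"
    using M unfolding invertible_mat_def by blast
  then have N: "N i 0 * M 0 j + N i 1 * M 1 j + N i 2 * M 2 j = (if i = j then 1 else 0)"
      "M i 0 * N 0 j + M i 1 * N 1 j + M i 2 * N 2 j = (if i = j then 1 else 0)"
    if "i < 3" "j < 3" for i j
    using that unfolding sum_less_3 by blast+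
  have NM: "N i 0 * (M 0 0 * x + M 0 1 * y + M 0 2 * z) + N i 1 * (M 1 0 * x + M 1 1 * y + M 1 2 * z)
      + N i 2 * (M 2 0 * x + M 2 1 * y + M 2 2 * z)
      = (if i = 0 then 1 else 0) * x + (if i = 1 then 1 else 0) * y + (if i = 2 then 1 else 0) * z"
    if "i < 3" for i x y z
    using that by (intro row_times_matrix N) auto
  have MN: "M i 0 * (N 0 0 * x + N 0 1 * y + N 0 2 * z) + M i 1 * (N 1 0 * x + N 1 1 * y + N 1 2 * z)
      + M i 2 * (N 2 0 * x + N 2 1 * y + N 2 2 * z)
      = (if i = 0 then 1 else 0) * x + (if i = 1 then 1 else 0) * y + (if i = 2 then 1 else 0) * z"
    if "i < 3" for i x y z
    using that by (intro row_times_matrix N) auto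
  define G where "G = (\<lambda>(y1, y2, y3).
        (N 0 0 * (y1 - c 0) + N 0 1 * (y2 - c 1) + N 0 2 * (y3 - c 2),
         N 1 0 * (y1 - c 0) + N 1 1 * (y2 - c 1) + N 1 2 * (y3 - c 2),
         N 2 0 * (y1 - c 0) + N 2 1 * (y2 - c 1) + N 2 2 * (y3 - c 2)))"
  show ?thesis
  proof (rule polyautI)
    show "polymap F"
      unfolding polymap_def poly3_def F prod.case
      by (intro allI pfun_co pfun_add pfun_mult pfun_var pfun_const)
    show "polymap G"
      unfolding polymap_def poly3_def G_def prod.case
      by (intro allI pfun_co pfun_add pfun_diff pfun_mult pfun_var pfun_const)
    show "G (F x) = x" for x
      unfolding G_def F using NM[of 0] NM[of 1] NM[of 2] by (cases x) simp
    show "F (G x) = x" for x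
      unfolding G_def F using MN[of 0] MN[of 1] MN[of 2] by (cases x) simp
  qed
qed

lemma polyaut_tame: "tame F \<Longrightarrow> polyaut F"
  by (induction rule: tame.induct)
     (blast intro: polyaut_id polyaut_comp polyaut_inv polyaut_elem3 polyaut_affine3)+

lemma tame_comp: "tame F \<Longrightarrow> tame G \<Longrightarrow> tame (F \<circ> G)"
proof (induction rule: tame.induct)
  case (tame_gen g a)
  then show ?case using tame.tame_gen[of "g \<circ> G" a] unfolding comp_assoc by blast
next
  case (tame_gen_inv g a)
  then show ?case using tame.tame_gen_inv[of "g \<circ> G" a] unfolding comp_assoc by blast
next
  case tame_id
  then show ?case by (simp only: id_comp)
qed

lemma tame_funpow: "tame F \<Longrightarrow> tame (F ^^ k)"
  by (induction k) (simp_all only: funpow.simps tame_id tame_comp)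

lemma tame_inv: "tame F \<Longrightarrow> tame (inv F)"
proof (induction rule: tame.induct)
  case tame_id
  then show ?case by (simp only: inv_id tame.tame_id)
next
  case (tame_gen g a)
  have "tame (inv a)" using tame.tame_gen_inv[OF tame_id tame_gen.hyps(2)] by (simp only: comp_id)
  moreover have "bij g" "bij a"
    using tame_gen.hyps polyaut_tame polyaut_affine3 polyaut_elem3 unfolding polyaut_def by blast+
  ultimately show ?case using tame_gen.IH by (simp only: o_inv_distrib tame_comp)
next
  case (tame_gen_inv g a)
  have "tame a" using tame.tame_gen[OF tame_id tame_gen_inv.hyps(2)] by (simp only: comp_id)
  moreover have "bij g" "bij a"
    using tame_gen_inv.hyps polyaut_tame polyaut_affine3 polyaut_elem3 unfolding polyaut_def by blast+
  ultimately show ?case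
    using tame_gen_inv.IH by (simp only: o_inv_distrib bij_imp_bij_inv inv_inv_eq tame_comp)
qed

lemma tame_h_inv_map: "tame (h_inv_map :: 'a::field pt3 \<Rightarrow> 'a pt3)"
proof -
  define M where "M i j = (if (i, j) \<in> {(0, 2), (1, 0), (2, 1)} then 1 else (0::'a))" for i j :: nat
  have "invertible_mat 3 M"
    unfolding invertible_mat_def
    by (rule exI[of _ "\<lambda>i j. M j i"]) (simp add: all_less_3 sum_less_3 M_def)
  moreover have "h_inv_map = (\<lambda>(x1, x2, x3).
      (M 0 0 * x1 + M 0 1 * x2 + M 0 2 * x3 + 0, M 1 0 * x1 + M 1 1 * x2 + M 1 2 * x3 + 0,
       M 2 0 * x1 + M 2 1 * x2 + M 2 2 * x3 + 0))"
    by (simp add: h_inv_map_def M_def fun_eq_iff)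
  ultimately have "h_inv_map \<in> (affine3 :: ('a pt3 \<Rightarrow> 'a pt3) set)"
    unfolding affine3_def mem_Collect_eq by (intro exI[of _ M] exI[of _ "\<lambda>_. 0"] conjI)
  then show ?thesis using tame_gen[OF tame_id, of h_inv_map] unfolding comp_id by blast
qed

text \<open>Factor it as the elementary map adding \<open>x_2 x_3\<close> to \<open>x_1\<close>,
  followed by the swap of the first two coordinates.\<close>

lemma tame_g_inv_map: "tame (g_inv_map :: 'a::field pt3 \<Rightarrow> 'a pt3)"
proof -
  define M where "M i j = (if (i, j) \<in> {(0, 1), (1, 0), (2, 2)} then 1 else (0::'a))" for i j :: nat
  define swap where "swap = (\<lambda>(x1, x2, x3). (x2, x1, x3) :: 'a pt3)"
  define E where "E = (\<lambda>(x1, x2, x3). (x1 + x2 * x3, x2, x3) :: 'a pt3)"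
  have "invertible_mat 3 M"
    unfolding invertible_mat_def
    by (rule exI[of _ "\<lambda>i j. M j i"]) (simp add: all_less_3 sum_less_3 M_def)
  moreover have "swap = (\<lambda>(x1, x2, x3).
      (M 0 0 * x1 + M 0 1 * x2 + M 0 2 * x3 + 0, M 1 0 * x1 + M 1 1 * x2 + M 1 2 * x3 + 0,
       M 2 0 * x1 + M 2 1 * x2 + M 2 2 * x3 + 0))"
    by (simp add: swap_def M_def fun_eq_iff)
  ultimately have "swap \<in> affine3"
    unfolding affine3_def mem_Collect_eq by (intro exI[of _ M] exI[of _ "\<lambda>_. 0"] conjI)
  moreover have "E \<in> elem3"
    unfolding elem3_def E_def mem_Collect_eq
    by (rule exI[of _ "\<lambda>x. fst x * snd x"]) (simp add: pf2_mult pf2_fst pf2_snd)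
  ultimately have "tame (swap \<circ> (E \<circ> id))"
    by (intro tame_gen tame_id) auto
  moreover have "swap \<circ> (E \<circ> id) = g_inv_map"
    by (simp add: swap_def E_def g_inv_map_def fun_eq_iff)
  ultimately show ?thesis by simp
qed

section \<open>Walks in the complex\<close>

lemma mem_triangle_comb:
  assumes "V \<in> triangle F" "gs \<in> V"
  shows "\<exists>a b c e. \<forall>x. hd gs x = a * fst (F x) + b * fst (snd (F x)) + c * snd (snd (F x)) + e"
proof -
  have *: "\<exists>a b c e. \<forall>x. hd gs x = a * fst (F x) + b * fst (snd (F x)) + c * snd (snd (F x)) + e"
    if gs: "gs \<in> vtx (take r (comps F))" and r: "r = Suc 0 \<or> r = 2 \<or> r = 3" for r
  proof -
    have len: "length (take r (comps F)) = r" using r by (auto simp: comps_def)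
    obtain M c where "\<forall>i<r. gs ! i = (\<lambda>x. (\<Sum>j<r. M i j * (take r (comps F) ! j) x) + c i)"
      and "length gs = r"
      using gs unfolding vtx_def len by blast
    moreover have "0 < r" using r by auto
    ultimately have hd: "hd gs = (\<lambda>x. (\<Sum>j<r. M 0 j * (take r (comps F) ! j) x) + c 0)"
      by (metis hd_conv_nth length_greater_0_conv)
    show ?thesis
      \<comment> \<open>Coefficients of components beyond the first \<open>r\<close> are padded with
        0.\<close>
      by (rule exI[of _ "M 0 0"], rule exI[of _ "if r \<ge> 2 then M 0 1 else 0"],
          rule exI[of _ "if r \<ge> 3 then M 0 2 else 0"], rule exI[of _ "c 0"])
         (use r in \<open>auto simp: hd comps_def numeral_3_eq_3 numeral_2_eq_2\<close>)
  qed
  have "comps F = take 3 (comps F)" by (simp add: comps_def)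
  then show ?thesis
    using assms *[of 1] *[of 2] *[of 3] unfolding triangle_def by auto
qed

lemma sum_unit_row:
  "(\<Sum>l<r. (if i = l then 1 else 0) * a l) = (if i < r then a i else (0::'a::comm_ring_1))" for r :: nat
  by (subst sum.cong[OF refl, of _ _ "\<lambda>l. if i = l then a l else 0"]) auto

lemma vtx_self: "fs \<in> vtx (fs :: ('a::field pt3 \<Rightarrow> 'a) list)"
proof -
  let ?M = "\<lambda>i j. if i = j then 1 else (0::'a)"
  have "invertible_mat (length fs) ?M"
    unfolding invertible_mat_def by (intro exI[of _ ?M]) (simp add: sum_unit_row)
  moreover have "\<forall>i<length fs. fs ! i = (\<lambda>x. (\<Sum>j<length fs. ?M i j * (fs ! j) x) + 0)"
    by (simp add: sum_unit_row)
  ultimately show ?thesis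
    unfolding vtx_def mem_Collect_eq by (intro conjI refl exI[of _ ?M] exI[of _ "\<lambda>_. 0"])
qed

text \<open>All three lists spanning the triangle begin with the first component of
  \<open>F\<close>; this shared component carries a level across an edge.\<close>

lemma triangle_first_component:
  assumes "V \<in> triangle F"
  obtains gs where "gs \<in> V" "hd gs = (\<lambda>x. fst (F x))"
proof -
  have "hd (take 1 (comps F)) = (\<lambda>x. fst (F x))" "hd (take 2 (comps F)) = (\<lambda>x. fst (F x))"
    "hd (comps F) = (\<lambda>x. fst (F x))"
    by (simp_all add: comps_def)
  then show thesis
    using assms that vtx_self unfolding triangle_def by blast
qed

lemma mem_vtx_singleton:
  assumes "gs \<in> vtx [u]"
  obtains a c where "a \<noteq> 0" "hd gs = (\<lambda>x. a * u x + c)"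
proof -
  obtain M c where M: "invertible_mat 1 M" "gs ! 0 = (\<lambda>x. M 0 0 * u x + c (0::nat))" "length gs = 1"
    using assms by (auto simp: vtx_def)
  then have "hd gs = (\<lambda>x. M 0 0 * u x + c 0)" by (metis hd_conv_nth length_0_conv zero_neq_one)
  moreover have "M 0 0 \<noteq> 0" using M(1) by (auto simp: invertible_mat_def)
  ultimately show thesis using that by blast
qed

text \<open>Precomposition commutes with the affine post-composition that defines the
  orbits.\<close>

lemma act_vtx:
  assumes "bij G"
  shows "act G (vtx fs) = vtx (map (\<lambda>u. u \<circ> inv G) fs)"
proof -
  have *: "map (\<lambda>u. u \<circ> H) gs \<in> vtx (map (\<lambda>u. u \<circ> H) fs)" if mem: "gs \<in> vtx fs"
    for H and gs fs :: "('a pt3 \<Rightarrow> 'a) list"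
  proof -
    obtain M c where M: "invertible_mat (length fs) M" and len: "length gs = length fs"
      and gs: "\<forall>i<length fs. gs ! i = (\<lambda>x. (\<Sum>j<length fs. M i j * (fs ! j) x) + c i)"
      using mem unfolding vtx_def by blast
    have "\<forall>i<length fs. map (\<lambda>u. u \<circ> H) gs ! i
        = (\<lambda>x. (\<Sum>j<length fs. M i j * (map (\<lambda>u. u \<circ> H) fs ! j) x) + c i)"
      using gs len by (auto simp: o_def intro!: sum.cong)
    then show ?thesis using M len unfolding vtx_def length_map mem_Collect_eq
      by (intro conjI exI[of _ M] exI[of _ c])
  qed
  have G: "inv G \<circ> G = id" "G \<circ> inv G = id"
    using assms by (simp_all only: inj_iff[symmetric] surj_iff[symmetric] bij_def)
  have "gs \<in> act G (vtx fs)" if "gs \<in> vtx (map (\<lambda>u. u \<circ> inv G) fs)" for gs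
  proof -
    have "map (\<lambda>u. u \<circ> G) gs \<in> vtx fs"
      using *[OF that, of G] by (simp add: comp_assoc G o_def[of "\<lambda>u. u \<circ> G"])
    moreover have "gs = map (\<lambda>u. u \<circ> inv G) (map (\<lambda>u. u \<circ> G) gs)"
      by (simp add: comp_assoc G o_def[of "\<lambda>u. u \<circ> inv G"])
    ultimately show ?thesis unfolding act_def by blast
  qed
  then show ?thesis using *[of _ fs "inv G"] unfolding act_def by blast
qed

section \<open>Levels of vertices and their change along walks\<close>

lemma C_walk_vertices: "C_walk m u v \<Longrightarrow> u \<in> C_vertices \<and> v \<in> C_vertices"
  by (induction rule: C_walk.induct) (auto simp: C_adj_def C_vertices_def)

text \<open>\<theta> \<open>j\<close> is \<open>f^j\<close> up to a fixed shift of the exponent;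
  different shifts serve positive and negative powers of \<open>f\<close>.\<close>

locale forward_levels =
  fixes n :: nat and \<theta> :: "nat \<Rightarrow> 'a::field_char_0 pt3 \<Rightarrow> 'a pt3"
  assumes n: "n \<ge> 2"
    and \<theta>_polyaut: "\<And>j. polyaut (\<theta> j)"
    and \<theta>_step: "\<And>j x. \<theta> j x = \<theta> (Suc j) ((h_inv_map \<circ> g_inv_map ^^ n) x)"
begin

lemma adm: "admissible ((next_weight n ^^ j) (\<lambda>_. 1))"
  using n by (intro admissible_funpow_next_weight) simp

text \<open>The affine action can bring any component of a vertex to the front, so heads suffice.
  The weights evolve with \<open>j\<close> so that one step of \<theta> pulls them back
  correctly.\<close>

definition level :: "nat \<Rightarrow> ('a pt3 \<Rightarrow> 'a) list set \<Rightarrow> bool" where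
  "level j V \<longleftrightarrow> (\<exists>gs\<in>V. forward ((next_weight n ^^ j) (\<lambda>_. 1)) (\<lambda>x. hd gs (\<theta> j x)))"

text \<open>Apply \<open>forward_neighbour\<close> to \<open>F \<circ> \<theta> j\<close>: the head
  in \<open>V\<close> is an affine combination of the components of \<open>F\<close>, and the first
  component of \<open>F\<close> lies in \<open>V'\<close>.\<close>

lemma level_triangle:
  assumes "tame F" "V \<in> triangle F" "V' \<in> triangle F" "level (Suc j) V"
  shows "level j V'"
proof -
  let ?W = "(next_weight n ^^ j) (\<lambda>_. 1)"
  obtain gs where gs: "gs \<in> V" "forward (next_weight n ?W) (\<lambda>x. hd gs (\<theta> (Suc j) x))"
    using assms(4) by (auto simp: level_def)
  obtain a b c e where comb: "\<And>x. hd gs x = a * fst (F x) + b * fst (snd (F x)) + c * snd (snd (F x)) + e"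
    using mem_triangle_comb[OF assms(2) gs(1)] by blast
  have "polyaut (F \<circ> \<theta> j)" using assms(1) by (intro polyaut_comp polyaut_tame \<theta>_polyaut)
  then have "forward ?W (\<lambda>x. fst ((F \<circ> \<theta> j) x))"
    by (rule forward_neighbour[OF n adm gs(2)]) (simp add: comb \<theta>_step[of j])
  moreover obtain hs where "hs \<in> V'" "hd hs = (\<lambda>x. fst (F x))"
    using triangle_first_component[OF assms(3)] .
  ultimately show ?thesis unfolding level_def by (intro bexI[of _ hs]) simp_all
qed

text \<open>With \<open>V' = V\<close>, \<open>level_triangle\<close> shows that the levels of a
  vertex are closed downwards.\<close>

lemma level_descend: "V \<in> C_vertices \<Longrightarrow> level (j + k) V \<Longrightarrow> level j V"
  by (induction k) (auto simp: C_vertices_def intro: level_triangle)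

lemma level_walk: "C_walk m u v \<Longrightarrow> (level (j + m) u \<longrightarrow> level j v) \<and> (level (j + m) v \<longrightarrow> level j u)"
proof (induction arbitrary: j rule: C_walk.induct)
  case (walk_cons u v m w)
  then obtain F where F: "tame F" "u \<in> triangle F" "v \<in> triangle F" by (auto simp: C_adj_def)
  show ?case
    using walk_cons.IH[of j] walk_cons.IH[of "Suc j"]
      level_triangle[OF F(1,2,3), of "j + m"] level_triangle[OF F(1,3,2), of j]
    unfolding add_Suc_right add_Suc by blast
qed simp

text \<open>The vertex of \<open>A\<close> has level \<open>N\<close>, as \<open>x_3\<close> is
  forward; that of \<open>B\<close> lacks level 0, as its heads pull back to
  \<open>a x_1 + c\<close> with \<open>a\<close> nonzero. Each edge loses at most one level.\<close>

lemma walk_length_gt: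
  assumes A: "\<And>x. fst (A (\<theta> N x)) = snd (snd x)" and B: "\<And>x. fst (B (\<theta> 0 x)) = fst x"
    and walk: "C_walk m (vtx [\<lambda>x. fst (A x)]) (vtx [\<lambda>x. fst (B x)])
      \<or> C_walk m (vtx [\<lambda>x. fst (B x)]) (vtx [\<lambda>x. fst (A x)])"
  shows "m > N"
proof (rule ccontr)
  assume "\<not> m > N"
  then have N: "N = 0 + (N - m) + m" by simp
  have "level N (vtx [\<lambda>x. fst (A x)])"
    unfolding level_def
    by (rule bexI[OF _ vtx_self]) (simp add: A forward_third_coordinate adm del: One_nat_def)
  then have "level (0 + (N - m) + m) (vtx [\<lambda>x. fst (A x)])" using N by simp
  then have "level (0 + (N - m)) (vtx [\<lambda>x. fst (B x)])"
    using walk level_walk by blast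
  moreover have "vtx [\<lambda>x. fst (B x)] \<in> C_vertices"
    using walk C_walk_vertices by blast
  ultimately have "level 0 (vtx [\<lambda>x. fst (B x)])"
    using level_descend[of _ 0] by blast
  then obtain gs where gs: "gs \<in> vtx [\<lambda>x. fst (B x)]" "forward (\<lambda>_. 1) (\<lambda>x. hd gs (\<theta> 0 x))"
    by (auto simp: level_def simp del: One_nat_def)
  obtain a c where "a \<noteq> 0" "hd gs = (\<lambda>x. a * fst (B x) + c)"
    using mem_vtx_singleton[OF gs(1)] .
  then show False
    using gs(2) not_forward_first_coordinate[of a "\<lambda>_. 1" c] by (simp add: B del: One_nat_def)
qed

end

lemma funpow_cancel:
  fixes p q :: "'b \<Rightarrow> 'b"
  assumes "\<And>x. p (q x) = x"
  shows "(p ^^ k) ((q ^^ k) x) = x"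
proof (induction k)
  case (Suc k)
  have "(p ^^ Suc k) ((q ^^ Suc k) x) = (p ^^ k) (p (q ((q ^^ k) x)))"
    by (simp add: funpow_swap1)
  then show ?case using Suc assms by simp
qed simp

section \<open>Linear growth of distances along the orbit of \<open>[x_1]\<close>\<close>

theorem theoremC:
  fixes n :: nat
  assumes "n \<ge> 3"
  defines "g \<equiv> inv (g_inv_map :: 'a::field_char_0 pt3 \<Rightarrow> 'a pt3)"
      and "h \<equiv> inv (h_inv_map :: 'a pt3 \<Rightarrow> 'a pt3)"
  shows "tame g \<and> tame h \<and> loxodromic (g ^^ n \<circ> h) \<and> infinite_diameter TYPE('a)"
proof -
  define f where "f = g ^^ n \<circ> h"
  define \<phi> where "\<phi> = h_inv_map \<circ> (g_inv_map :: 'a pt3 \<Rightarrow> 'a pt3) ^^ n"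
  have tame_g: "tame g" and tame_h: "tame h"
    unfolding g_def h_def by (intro tame_inv tame_g_inv_map tame_h_inv_map)+
  have tame_f: "tame f" and tame_\<phi>: "tame \<phi>"
    unfolding f_def \<phi>_def by (intro tame_comp tame_funpow tame_g tame_h tame_g_inv_map tame_h_inv_map)+
  have tame_bij: "bij F" if "tame F" for F :: "'a pt3 \<Rightarrow> 'a pt3"
    using polyaut_tame[OF that] by (simp add: polyaut_def)
  have f_inv_\<phi>: "f = inv \<phi>"
    unfolding f_def \<phi>_def g_def h_def
    using tame_bij[OF tame_g_inv_map] tame_bij[OF tame_h_inv_map]
    by (simp only: o_inv_distrib bij_fn inv_fn)
  have f\<phi>: "f (\<phi> x) = x" and \<phi>f: "\<phi> (f x) = x" for x
    using tame_bij[OF tame_\<phi>] by (simp_all add: f_inv_\<phi> bij_is_inj bij_is_surj surj_f_inv_f)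
  have pow_cancel: "(f ^^ k) ((\<phi> ^^ k) x) = x" "(\<phi> ^^ k) ((f ^^ k) x) = x" for k x
    using funpow_cancel[of f \<phi>] funpow_cancel[of \<phi> f] f\<phi> \<phi>f by blast+
  then have inv_pow: "inv (f ^^ k) = \<phi> ^^ k" "inv (\<phi> ^^ k) = f ^^ k" for k
    by (intro inv_unique_comp ext; simp)+
  have inv_f: "inv f = \<phi>" using inv_pow(1)[of 1] by simp
  have fst_\<phi>: "fst (\<phi> x) = snd (snd x)" for x
    by (simp add: \<phi>_def g_inv_map_funpow h_inv_map_def)
  have pow_\<phi>: "(f ^^ j) x = (f ^^ Suc j) (\<phi> x)" for j x
    by (simp add: funpow_swap1 f\<phi>)
  have auts: "polyaut (f ^^ j)" "polyaut (\<phi> ^^ j)" for j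
    using tame_f tame_\<phi> by (auto intro: polyaut_funpow polyaut_tame)
  define x0 :: "('a pt3 \<Rightarrow> 'a) list set" where "x0 = vtx [\<lambda>x. fst x]"
  have act_x0: "act F x0 = vtx [\<lambda>x. fst (inv F x)]" if "tame F" for F
    using act_vtx[OF tame_bij[OF that], of "[\<lambda>x. fst x]"] by (simp add: x0_def o_def)
  have vertex: "vtx [\<lambda>x. fst (F x)] \<in> C_vertices" if "tame F" for F :: "'a pt3 \<Rightarrow> 'a pt3"
    using that by (auto simp: C_vertices_def triangle_def comps_def)
  have x0_vertex: "x0 \<in> C_vertices" using vertex[OF tame_id] by (simp add: x0_def)
  have bound: "\<bar>k\<bar> \<le> int m" if walk: "C_walk m x0 (act (ipow f k) x0)" for k m
  proof (cases "k = 0")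
    case False
    \<comment> \<open>With \<open>N\<close> one less than the absolute value of \<open>k\<close>,
      the strict bound \<open>m > N\<close> is exactly the desired one.\<close>
    then obtain N where N: "nat \<bar>k\<bar> = Suc N" by (metis nat_0_iff abs_le_zero_iff old.nat.exhaust)
    have "m > N"
    proof (cases "k > 0")
      case True
      interpret forward_levels n "\<lambda>j. f ^^ j"
      proof
        show "n \<ge> 2" using assms(1) by simp
        show "(f ^^ j) x = (f ^^ Suc j) ((h_inv_map \<circ> g_inv_map ^^ n) x)" for j x
          using pow_\<phi> by (simp only: \<phi>_def)
      qed (rule auts)
      \<comment> \<open>For positive \<open>k\<close> the translated vertex is the high one: at
        level \<open>N\<close>, its component pulls back to the first component of \<phi>, which is
        \<open>x_3\<close>.\<close>
      have "act (ipow f k) x0 = vtx [\<lambda>x. fst ((\<phi> ^^ Suc N) x)]"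
        using True N act_x0[OF tame_funpow[OF tame_f], of "Suc N"]
        by (simp add: ipow_def inv_pow del: funpow.simps)
      then show ?thesis
        using walk by (intro walk_length_gt[of "\<phi> ^^ Suc N" N id])
          (auto simp: pow_cancel fst_\<phi> x0_def)
    next
      case neg: False
      \<comment> \<open>For negative \<open>k\<close> the roles swap: \<theta> \<open>j\<close> is
        \<open>f^(j - N - 1)\<close>, so \<theta> \<open>N\<close> is \<phi>, which takes
        \<open>x_1\<close> to \<open>x_3\<close>, while \<theta> \<open>0\<close> cancels
        \<open>f^(N+1)\<close>.\<close>
      define \<theta> where "\<theta> j = (if j \<le> Suc N then \<phi> ^^ (Suc N - j) else f ^^ (j - Suc N))" for j
      have "\<theta> j x = \<theta> (Suc j) (\<phi> x)" for j x
      proof -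
        consider "j < Suc N" | "j = Suc N" | "j > Suc N" by linarith
        then show ?thesis
        proof cases
          case 1
          then have "Suc N - j = Suc (N - j)" by simp
          then show ?thesis using 1 by (simp add: \<theta>_def funpow_swap1)
        next
          case 2
          then show ?thesis by (simp add: \<theta>_def f\<phi>)
        next
          case 3
          then have "j - N = Suc (j - Suc N)" by simp
          then show ?thesis using 3 pow_\<phi>[of "j - Suc N" x]
            by (simp add: \<theta>_def del: funpow.simps)
        qed
      qed
      note \<theta>_step = this
      interpret forward_levels n \<theta>
      proof
        show "n \<ge> 2" using assms(1) by simp
        show "\<theta> j x = \<theta> (Suc j) ((h_inv_map \<circ> g_inv_map ^^ n) x)" for j x
          using \<theta>_step by (simp only: \<phi>_def)
        show "polyaut (\<theta> j)" for j using auts by (simp add: \<theta>_def)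
      qed
      have "act (ipow f k) x0 = vtx [\<lambda>x. fst ((f ^^ Suc N) x)]"
        using False neg N act_x0[OF tame_funpow[OF tame_\<phi>], of "Suc N"]
        by (simp add: ipow_def inv_f inv_pow del: funpow.simps)
      moreover have "fst (\<theta> N x) = snd (snd x)" for x
        by (simp add: \<theta>_def fst_\<phi>)
      moreover have "fst ((f ^^ Suc N) (\<theta> 0 x)) = fst x" for x
        using pow_cancel(1)[of "Suc N" x] by (simp add: \<theta>_def del: funpow.simps)
      ultimately show ?thesis
        using walk by (intro walk_length_gt[of id N "f ^^ Suc N"]) (auto simp: x0_def)
    qed
    then show ?thesis using N by linarith
  qed simp
  have "loxodromic f"
    unfolding loxodromic_def
  proof (intro bexI[OF _ x0_vertex] exI[of _ 1] conjI allI impI)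
    fix k m assume "C_walk m x0 (act (ipow f k) x0)"
    then have "real_of_int \<bar>k\<bar> \<le> real_of_int (int m)" using bound of_int_le_iff by blast
    then show "real m \<ge> 1 * \<bar>real_of_int k\<bar>" by simp
  qed simp
  moreover have "infinite_diameter TYPE('a)"
    unfolding infinite_diameter_def
  proof (intro allI exI conjI)
    fix N :: nat
    show "x0 \<in> C_vertices" by (rule x0_vertex)
    have "ipow f (int (Suc N)) = f ^^ Suc N"
      by (simp only: ipow_def nat_int of_nat_0_le_iff if_True)
    then have "act (ipow f (int (Suc N))) x0 = vtx [\<lambda>x. fst ((\<phi> ^^ Suc N) x)]"
      using act_x0[OF tame_funpow[OF tame_f]] by (simp only: inv_pow)
    then show "act (ipow f (int (Suc N))) x0 \<in> C_vertices"
      using vertex[OF tame_funpow[OF tame_\<phi>]] by metis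
    show "\<not> (\<exists>m\<le>N. C_walk m x0 (act (ipow f (int (Suc N))) x0))"
      using bound by fastforce
  qed
  ultimately show ?thesis using tame_g tame_h by (simp add: f_def)
qed

end
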